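(* If $(\mathfrak A,\mathsf L_{\mathfrak A})$ and $(\mathfrak B,\mathsf L_{\mathfrak B})$ are two quantum metric order unit spaces, then $$\mathrm{dist}_q((\mathfrak A,\mathsf L_{\mathfrak A}),(\mathfrak B,\mathsf L_{\mathfrak B}))=\inf\{\chi(\tau):\tau\text{ is an order unit tunnel from }(\mathfrak A,\mathsf L_{\mathfrak A})\text{ to }(\mathfrak B,\mathsf L_{\mathfrak B})\}.$$
   Context: An order unit space $\mathfrak A$ is an ordered real vector space with a distinguished $1_{\mathfrak A}$ such that for each $a$ there is $\lambda>0$ with $-\lambda 1_{\mathfrak A}\le a\le\lambda 1_{\mathfrak A}$, and which is Archimedean ($a\le\lambda 1_{\mathfrak A}$ for all $\lambda>0$ implies $a\le 0$). Its norm is $\|a\|=\inf\{\lambda>0:-\lambda 1_{\mathfrak A}\le a\le\lambda 1_{\mathfrak A}\}$. Its state space $\mathscr S(\mathfrak A)$ is the set of positive linear functionals $\mathfrak A\to\mathbb R$ taking value $1$ at $1_{\mathfrak A}$. A quantum metric order unit space $(\mathfrak A,\mathsf L)$ is a norm-complete order unit space with a seminorm $\mathsf L$ (a Lip-norm) defined on a norm-dense subspace (convention: $\mathsf L=\infty$ outside) such that: (1) $\{a:\mathsf L(a)=0\}=\mathbb R1_{\mathfrak A}$; (2) $\mathsf{mk}_{\mathsf L}(\varphi,\psi)=\sup\{|\varphi(a)-\psi(a)|:\mathsf L(a)\le 1\}$ is a metric inducing the weak* topology on $\mathscr S(\mathfrak A)$; (3) $\{a:\mathsf L(a)\le 1\}$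 is norm-closed. For two such spaces $(\mathfrak A_1,\mathsf L_1),(\mathfrak A_2,\mathsf L_2)$, a Lip-norm $\mathsf L$ on $\mathfrak A_1\oplus\mathfrak A_2$ (coordinatewise order, unit $(1,1)$) is admissible if its quotient seminorm on $\mathfrak A_j$ (infimum of $\mathsf L$ over the other coordinate) is $\mathsf L_j$ for $j=1,2$. Rieffel's distance $\mathrm{dist}_q((\mathfrak A_1,\mathsf L_1),(\mathfrak A_2,\mathsf L_2))$ is the infimum over admissible $\mathsf L$ of the Hausdorff distance, for $\mathsf{mk}_{\mathsf L}$, between $\mathscr S(\mathfrak A_1)$ and $\mathscr S(\mathfrak A_2)$, both viewed in $\mathscr S(\mathfrak A_1\oplus\mathfrak A_2)$ via the coordinate projections. A quantum order-unit isometry $\pi:(\mathfrak A,\mathsf L_{\mathfrak A})\to(\mathfrak B,\mathsf L_{\mathfrak B})$ is a positive linear map $\mathfrak A\to\mathfrak B$ mapping order unit to order unit with $\mathsf L_{\mathfrak B}(b)=\inf\{\mathsf L_{\mathfrak A}(a):\pi(a)=b\}$ for all $b\in\mathfrak B$. An order unit tunnel $\tau=(\mathfrak D,\mathsf L_{\mathfrak D},\pi_1,\pi_2)$ from $(\mathfrak A_1,\mathsf L_1)$ to $(\mathfrak A_2,\mathsf L_2)$ consists of a quantum metric order unit space $(\mathfrak D,\mathsf L_{\mathfrak D})$ and quantum order-unit isometries $\pi_j$ from $(\mathfrak D,\mathsf L_{\mathfrak D})$ onto $(\mathfrak A_j,\mathsf L_j)$. Its extent is $\chi(\tau)=\max_{j\in\{1,2\}}\mathrm{Haus}_{\mathsf{mk}_{\mathsf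 L_{\mathfrak D}}}\big(\mathscr S(\mathfrak D),\{\varphi\circ\pi_j:\varphi\in\mathscr S(\mathfrak A_j)\}\big)$, where $\mathrm{Haus}_d$ is the Hausdorff distance for $d$. *)

theory Defs
  imports "HOL-Analysis.Analysis"
begin

section \<open>Order unit spaces\<close>

text \<open>
  The underlying vector space is a linear subspace of an ambient real vector space, so that
  quantification over spaces is quantification over subspaces, orders and units. Only the values
  of the order on the carrier matter, and likewise below for Lip-norms and maps.
\<close>

record 'a ou_space =
  carr :: "'a set"
  leq :: "'a \<Rightarrow> 'a \<Rightarrow> bool"
  ounit :: 'a

definition ordered_vs :: "'a::real_vector ou_space \<Rightarrow> bool" where
  "ordered_vs A \<longleftrightarrow>
     subspace (carr A) \<and>
     (\<forall>a\<in>carr A. leq A a a) \<and>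
     (\<forall>a\<in>carr A. \<forall>b\<in>carr A. leq A a b \<longrightarrow> leq A b a \<longrightarrow> a = b) \<and>
     (\<forall>a\<in>carr A. \<forall>b\<in>carr A. \<forall>c\<in>carr A. leq A a b \<longrightarrow> leq A b c \<longrightarrow> leq A a c) \<and>
     (\<forall>a\<in>carr A. \<forall>b\<in>carr A. \<forall>c\<in>carr A. leq A a b \<longrightarrow> leq A (a + c) (b + c)) \<and>
     (\<forall>t\<ge>0. \<forall>a\<in>carr A. \<forall>b\<in>carr A. leq A a b \<longrightarrow> leq A (t *\<^sub>R a) (t *\<^sub>R b))"

definition order_unit_space :: "'a::real_vector ou_space \<Rightarrow> bool" where
  "order_unit_space A \<longleftrightarrow>
     ordered_vs A \<and>
     ounit A \<in> carr A \<and>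
     (\<forall>a\<in>carr A. \<exists>t>0. leq A (- (t *\<^sub>R ounit A)) a \<and> leq A a (t *\<^sub>R ounit A)) \<and>
     (\<forall>a\<in>carr A. (\<forall>t>0. leq A a (t *\<^sub>R ounit A)) \<longrightarrow> leq A a 0)"

definition ou_norm :: "'a::real_vector ou_space \<Rightarrow> 'a \<Rightarrow> real" where
  "ou_norm A a = Inf {t. t > 0 \<and> leq A (- (t *\<^sub>R ounit A)) a \<and> leq A a (t *\<^sub>R ounit A)}"

text \<open>
  The value \<open>0\<close> off the carrier is there because \<^locale>\<open>Metric_space\<close> asks for nonnegativity and
  symmetry at all points of the type.
\<close>

definition ou_dist :: "'a::real_vector ou_space \<Rightarrow> 'a \<Rightarrow> 'a \<Rightarrow> real" where
  "ou_dist A a b = (if a \<in> carr A \<and> b \<in> carr A then ou_norm A (a - b) else 0)"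

definition norm_topology :: "'a::real_vector ou_space \<Rightarrow> 'a topology" where
  "norm_topology A = Metric_space.mtopology (carr A) (ou_dist A)"

definition norm_complete :: "'a::real_vector ou_space \<Rightarrow> bool" where
  "norm_complete A \<longleftrightarrow> Metric_space.mcomplete (carr A) (ou_dist A)"

definition direct_sum :: "'a ou_space \<Rightarrow> 'b ou_space \<Rightarrow> ('a \<times> 'b) ou_space" where
  "direct_sum A B =
     \<lparr>carr = carr A \<times> carr B,
      leq = (\<lambda>x y. leq A (fst x) (fst y) \<and> leq B (snd x) (snd y)),
      ounit = (ounit A, ounit B)\<rparr>"


section \<open>Positive unital maps and states\<close>

definition lin_on :: "'a::real_vector set \<Rightarrow> ('a \<Rightarrow> 'b::real_vector) \<Rightarrow> bool" where
  "lin_on V f \<longleftrightarrow>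
     (\<forall>x\<in>V. \<forall>y\<in>V. f (x + y) = f x + f y) \<and> (\<forall>t. \<forall>x\<in>V. f (t *\<^sub>R x) = t *\<^sub>R f x)"

text \<open>
  A functional on a space is represented by the function that is \<^term>\<open>undefined\<close> off the carrier,
  so that equality of states is equality on the carrier.
\<close>

definition states :: "'a::real_vector ou_space \<Rightarrow> ('a \<Rightarrow> real) set" where
  "states A = {\<phi> \<in> extensional (carr A).
     lin_on (carr A) \<phi> \<and> (\<forall>a\<in>carr A. leq A 0 a \<longrightarrow> 0 \<le> \<phi> a) \<and> \<phi> (ounit A) = 1}"

definition weak_star :: "'a::real_vector ou_space \<Rightarrow> ('a \<Rightarrow> real) topology" where
  "weak_star A = subtopology (product_topology (\<lambda>_. euclideanreal) (carr A)) (states A)"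

definition positive_unital :: "'a::real_vector ou_space \<Rightarrow> 'b::real_vector ou_space \<Rightarrow> ('a \<Rightarrow> 'b) \<Rightarrow> bool" where
  "positive_unital A B \<pi> \<longleftrightarrow>
     \<pi> \<in> carr A \<rightarrow> carr B \<and> lin_on (carr A) \<pi> \<and>
     (\<forall>a\<in>carr A. leq A 0 a \<longrightarrow> leq B 0 (\<pi> a)) \<and> \<pi> (ounit A) = ounit B"

text \<open>The set of all \<open>\<phi> \<circ> \<pi>\<close>, where \<open>\<phi>\<close> is a state of \<open>B\<close> and \<open>\<pi>\<close> is a map from \<open>A\<close> to \<open>B\<close>.\<close>

definition pullback_states ::
  "'a::real_vector ou_space \<Rightarrow> 'b::real_vector ou_space \<Rightarrow> ('a \<Rightarrow> 'b) \<Rightarrow> ('a \<Rightarrow> real) set" where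
  "pullback_states A B \<pi> = (\<lambda>\<phi>. compose (carr A) \<phi> \<pi>) ` states B"


section \<open>Quantum metric order unit spaces\<close>

definition mk :: "'a ou_space \<Rightarrow> ('a \<Rightarrow> ennreal) \<Rightarrow> ('a \<Rightarrow> real) \<Rightarrow> ('a \<Rightarrow> real) \<Rightarrow> ennreal" where
  "mk A L \<phi> \<psi> = (SUP a \<in> {a \<in> carr A. L a \<le> 1}. ennreal \<bar>\<phi> a - \<psi> a\<bar>)"

definition lip_dom :: "'a ou_space \<Rightarrow> ('a \<Rightarrow> ennreal) \<Rightarrow> 'a set" where
  "lip_dom A L = {a \<in> carr A. L a < \<infinity>}"

definition seminorm_on :: "'a::real_vector set \<Rightarrow> ('a \<Rightarrow> ennreal) \<Rightarrow> bool" where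
  "seminorm_on V L \<longleftrightarrow>
     (\<forall>x\<in>V. \<forall>y\<in>V. L (x + y) \<le> L x + L y) \<and> (\<forall>t. \<forall>x\<in>V. L (t *\<^sub>R x) = ennreal \<bar>t\<bar> * L x)"

definition lip_norm :: "'a::real_vector ou_space \<Rightarrow> ('a \<Rightarrow> ennreal) \<Rightarrow> bool" where
  "lip_norm A L \<longleftrightarrow>
     subspace (lip_dom A L) \<and>
     norm_topology A closure_of lip_dom A L = carr A \<and>
     seminorm_on (lip_dom A L) L \<and>
     {a \<in> carr A. L a = 0} = range (\<lambda>t. t *\<^sub>R ounit A) \<and>
     (\<forall>\<phi>\<in>states A. \<forall>\<psi>\<in>states A. mk A L \<phi> \<psi> < \<infinity>) \<and>
     Metric_space (states A) (\<lambda>\<phi> \<psi>. enn2real (mk A L \<phi> \<psi>)) \<and>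
     Metric_space.mtopology (states A) (\<lambda>\<phi> \<psi>. enn2real (mk A L \<phi> \<psi>)) = weak_star A \<and>
     closedin (norm_topology A) {a \<in> carr A. L a \<le> 1}"

definition quantum_metric_ou_space :: "'a::real_vector ou_space \<Rightarrow> ('a \<Rightarrow> ennreal) \<Rightarrow> bool" where
  "quantum_metric_ou_space A L \<longleftrightarrow> order_unit_space A \<and> norm_complete A \<and> lip_norm A L"


section \<open>Rieffel's distance\<close>

definition hausdorff_distance :: "('x \<Rightarrow> 'x \<Rightarrow> ennreal) \<Rightarrow> 'x set \<Rightarrow> 'x set \<Rightarrow> ennreal" where
  "hausdorff_distance d X Y = max (SUP x\<in>X. INF y\<in>Y. d x y) (SUP y\<in>Y. INF x\<in>X. d x y)"

definition admissible ::
  "'a::real_vector ou_space \<Rightarrow> ('a \<Rightarrow> ennreal) \<Rightarrow> 'b::real_vector ou_space \<Rightarrow> ('b \<Rightarrow> ennreal) \<Rightarrow>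
   ('a \<times> 'b \<Rightarrow> ennreal) \<Rightarrow> bool" where
  "admissible A LA B LB L \<longleftrightarrow>
     lip_norm (direct_sum A B) L \<and>
     (\<forall>a\<in>carr A. LA a = (INF b\<in>carr B. L (a, b))) \<and>
     (\<forall>b\<in>carr B. LB b = (INF a\<in>carr A. L (a, b)))"

definition dist_q ::
  "'a::real_vector ou_space \<Rightarrow> ('a \<Rightarrow> ennreal) \<Rightarrow> 'b::real_vector ou_space \<Rightarrow> ('b \<Rightarrow> ennreal) \<Rightarrow> ennreal" where
  "dist_q A LA B LB =
     (INF L \<in> {L. admissible A LA B LB L}.
        hausdorff_distance (mk (direct_sum A B) L)
          (pullback_states (direct_sum A B) A fst) (pullback_states (direct_sum A B) B snd))"


section \<open>Order unit tunnels\<close>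

definition quantum_ou_isometry ::
  "'a::real_vector ou_space \<Rightarrow> ('a \<Rightarrow> ennreal) \<Rightarrow> 'b::real_vector ou_space \<Rightarrow> ('b \<Rightarrow> ennreal) \<Rightarrow>
   ('a \<Rightarrow> 'b) \<Rightarrow> bool" where
  "quantum_ou_isometry A LA B LB \<pi> \<longleftrightarrow>
     positive_unital A B \<pi> \<and> (\<forall>b\<in>carr B. LB b = (INF a \<in> {a \<in> carr A. \<pi> a = b}. LA a))"

record ('d, 'a, 'b) tunnel =
  tspace :: "'d ou_space"
  tlip :: "'d \<Rightarrow> ennreal"
  tleft :: "'d \<Rightarrow> 'a"
  tright :: "'d \<Rightarrow> 'b"

definition ou_tunnel ::
  "'a::real_vector ou_space \<Rightarrow> ('a \<Rightarrow> ennreal) \<Rightarrow> 'b::real_vector ou_space \<Rightarrow> ('b \<Rightarrow> ennreal) \<Rightarrow>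
   ('d::real_vector, 'a, 'b) tunnel \<Rightarrow> bool" where
  "ou_tunnel A LA B LB \<tau> \<longleftrightarrow>
     quantum_metric_ou_space (tspace \<tau>) (tlip \<tau>) \<and>
     quantum_ou_isometry (tspace \<tau>) (tlip \<tau>) A LA (tleft \<tau>) \<and>
     tleft \<tau> ` carr (tspace \<tau>) = carr A \<and>
     quantum_ou_isometry (tspace \<tau>) (tlip \<tau>) B LB (tright \<tau>) \<and>
     tright \<tau> ` carr (tspace \<tau>) = carr B"

definition extent ::
  "'a::real_vector ou_space \<Rightarrow> 'b::real_vector ou_space \<Rightarrow> ('d::real_vector, 'a, 'b) tunnel \<Rightarrow> ennreal" where
  "extent A B \<tau> =
     (let D = tspace \<tau>; d = mk D (tlip \<tau>)
      in max (hausdorff_distance d (states D) (pullback_states D A (tleft \<tau>)))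
             (hausdorff_distance d (states D) (pullback_states D B (tright \<tau>))))"

text \<open>
  HOL cannot quantify over types inside a formula, so the spaces of the tunnels have to live in
  one ambient type. It is taken to be \<open>'a \<times> 'b \<times> 'd\<close> with an arbitrary \<open>'d\<close>: for every \<open>'d\<close> this
  contains a copy of each space carried by \<open>'d\<close> (as \<open>{0} \<times> {0} \<times> D\<close>) and of the direct sum of the
  two given spaces (as \<open>A \<times> B \<times> {0}\<close>). A statement about the set of extents for all types \<open>'d\<close>
  thus takes every tunnel into account.
\<close>

definition tunnel_extents ::
  "'d::real_vector itself \<Rightarrow> 'a::real_vector ou_space \<Rightarrow> ('a \<Rightarrow> ennreal) \<Rightarrow>
   'b::real_vector ou_space \<Rightarrow> ('b \<Rightarrow> ennreal) \<Rightarrow> ennreal set" where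
  "tunnel_extents _ A LA B LB =
     {extent A B \<tau> | \<tau> :: ('a \<times> 'b \<times> 'd, 'a, 'b) tunnel. ou_tunnel A LA B LB \<tau>}"

end

theory Submission
  imports Defs
begin

text \<open>
  Both inequalities rest on explicit constructions between a direct sum and a tunnel.

  An admissible Lip-norm turns the direct sum, with the coordinate projections, into a tunnel. A
  state of the direct sum is a convex combination of a state of \<open>A\<close> and a state of \<open>B\<close>
  (\<open>state_direct_sum_cases\<close>). Replacing the second by a state of \<open>A\<close> near to it moves the
  combination by at most as much. Hence the extent of this tunnel is at most the Hausdorff distance
  of the two state spaces (\<open>extent_le_admissible\<close>).

  Conversely, let a tunnel through \<open>D\<close> with projections \<open>p\<close> and \<open>q\<close> be given, and let \<open>\<epsilon> > 0\<close>. Let \<open>k \<phi> \<psi>\<close> be the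
  distance in \<open>D\<close> of the pullbacks of a state \<open>\<phi>\<close> of \<open>A\<close> and a state \<open>\<psi>\<close> of \<open>B\<close>, plus \<open>\<epsilon>\<close>, and put
  \<open>L (a, b) = max {LA a, LB b, SUP \<phi> \<psi>. \<bar>\<phi> a - \<psi> b\<bar> / k \<phi> \<psi>}\<close>. In the metric of \<open>L\<close> the states \<open>\<phi>\<close> and
  \<open>\<psi>\<close> are at distance at most \<open>k \<phi> \<psi>\<close>, so the state spaces of \<open>A\<close> and \<open>B\<close> have
  Hausdorff distance at most the extent plus \<open>\<epsilon>\<close>. The quotients of \<open>L\<close> are right because
  \<open>L (p d, q d)\<close> is at most the seminorm of \<open>d\<close> for every \<open>d\<close> in \<open>D\<close> (\<open>dist_q_le_extent\<close>).

  The main labour is to see that \<open>L\<close> is a Lip-norm (\<open>lip_norm_bridge\<close>). For this the topological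
  clauses are rewritten as inequalities (\<open>lip_norm_iff\<close>). What remains is that states of
  the direct sum near to each other on finitely many elements are metrically near; this is inherited
  from the summands (\<open>lip_norm_uniform_on_functionals\<close>), once the unit ball of \<open>L\<close> is known to be
  bounded modulo multiples of the unit. The bound comes from the diameters of the state spaces,
  which are finite by convexity (\<open>lip_norm_bounded_diameter\<close>).
\<close>

section \<open>Order unit spaces and their norm\<close>

definition order_bounded :: "'a::real_vector ou_space \<Rightarrow> real \<Rightarrow> 'a \<Rightarrow> bool" where
  "order_bounded A t a \<longleftrightarrow> leq A (- (t *\<^sub>R ounit A)) a \<and> leq A a (t *\<^sub>R ounit A)"

locale ou =
  fixes A :: "'a::real_vector ou_space"
  assumes ou: "order_unit_space A"
begin

abbreviation "u \<equiv> ounit A"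
abbreviation "V \<equiv> carr A"
definition pos :: "'a \<Rightarrow> bool" where "pos a \<longleftrightarrow> leq A 0 a"

lemma ordered_vs_carr: "ordered_vs A"
  using ou by (simp add: order_unit_space_def)

lemma subspace_carr: "subspace V"
  using ordered_vs_carr by (simp add: ordered_vs_def)

lemma zero_mem [simp]: "0 \<in> V"
  and add_mem [simp]: "a \<in> V \<Longrightarrow> b \<in> V \<Longrightarrow> a + b \<in> V"
  and diff_mem [simp]: "a \<in> V \<Longrightarrow> b \<in> V \<Longrightarrow> a - b \<in> V"
  and minus_mem [simp]: "a \<in> V \<Longrightarrow> - a \<in> V"
  and scale_mem [simp]: "a \<in> V \<Longrightarrow> t *\<^sub>R a \<in> V"
  using subspace_carr by (auto simp: subspace_0 subspace_add subspace_diff subspace_neg subspace_scale)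

lemma unit_mem [simp]: "u \<in> V"
  using ou by (simp add: order_unit_space_def)

lemmas order_axioms = ordered_vs_carr[unfolded ordered_vs_def]
lemmas leq_refl = order_axioms[THEN conjunct2, THEN conjunct1]
lemmas leq_antisym = order_axioms[THEN conjunct2, THEN conjunct2, THEN conjunct1]
lemmas leq_trans = order_axioms[THEN conjunct2, THEN conjunct2, THEN conjunct2, THEN conjunct1]
lemmas leq_add =
  order_axioms[THEN conjunct2, THEN conjunct2, THEN conjunct2, THEN conjunct2, THEN conjunct1]
lemmas leq_scale =
  order_axioms[THEN conjunct2, THEN conjunct2, THEN conjunct2, THEN conjunct2, THEN conjunct2]

lemma leq_iff_pos:
  assumes "a \<in> V" "b \<in> V"
  shows "leq A a b \<longleftrightarrow> pos (b - a)"
proof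
  assume "leq A a b"
  then have "leq A (a + - a) (b + - a)" using leq_add[rule_format, OF assms minus_mem[OF assms(1)]] by simp
  then show "pos (b - a)" by (simp add: pos_def)
next
  assume "pos (b - a)"
  then have "leq A (0 + a) (b - a + a)" using leq_add[rule_format, OF zero_mem diff_mem[OF assms(2,1)] assms(1)] by (simp add: pos_def)
  then show "leq A a b" by simp
qed

lemma pos_0 [simp]: "pos 0"
  using leq_refl[rule_format, OF zero_mem] by (simp add: pos_def)

lemma pos_add:
  assumes "a \<in> V" "b \<in> V" "pos a" "pos b"
  shows "pos (a + b)"
proof -
  have "leq A a (a + b)" using assms by (simp add: leq_iff_pos)
  then show "pos (a + b)"
    using leq_trans[rule_format, OF zero_mem assms(1) add_mem[OF assms(1,2)]] assms(3) by (simp add: pos_def)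
qed

lemma pos_scale:
  assumes "a \<in> V" "0 \<le> t" "pos a"
  shows "pos (t *\<^sub>R a)"
proof -
  have "leq A (t *\<^sub>R 0) (t *\<^sub>R a)" using leq_scale[rule_format, OF assms(2) zero_mem assms(1)] assms(3) by (simp add: pos_def)
  then show ?thesis by (simp add: pos_def)
qed

lemma pos_antisym:
  assumes "a \<in> V" "pos a" "pos (- a)"
  shows "a = 0"
proof -
  have "leq A a 0" using assms by (simp add: leq_iff_pos)
  then show ?thesis using leq_antisym[rule_format, OF assms(1) zero_mem] assms(2) by (simp add: pos_def)
qed

lemma order_bounded_iff_pos:
  "a \<in> V \<Longrightarrow> order_bounded A t a \<longleftrightarrow> pos (t *\<^sub>R u - a) \<and> pos (t *\<^sub>R u + a)"
  by (auto simp: order_bounded_def leq_iff_pos algebra_simps)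

lemma order_bounded_ex: "a \<in> V \<Longrightarrow> \<exists>t>0. order_bounded A t a"
  using ou by (simp add: order_unit_space_def order_bounded_def)

lemma pos_unit: "pos u"
proof -
  obtain t where "t > 0" "order_bounded A t u" using order_bounded_ex[of u] by auto
  then have "pos ((1 / (t + 1)) *\<^sub>R (t *\<^sub>R u + u))"
    by (intro pos_scale) (auto simp: order_bounded_iff_pos)
  also have "(1 / (t + 1)) *\<^sub>R (t *\<^sub>R u + u) = u"
    using \<open>t > 0\<close> by (simp flip: scaleR_add_left add: scaleR_add_right field_simps)
  finally show ?thesis .
qed

lemma order_bounded_mono:
  assumes "a \<in> V" "order_bounded A s a" "s \<le> t"
  shows "order_bounded A t a"
proof -
  have "pos ((s *\<^sub>R u - a) + (t - s) *\<^sub>R u)" "pos ((s *\<^sub>R u + a) + (t - s) *\<^sub>R u)"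
    using assms pos_unit by (auto intro!: pos_add pos_scale simp: order_bounded_iff_pos)
  then show ?thesis
    using assms by (simp add: order_bounded_iff_pos algebra_simps)
qed

lemma order_bounded_add:
  assumes "a \<in> V" "b \<in> V" "order_bounded A s a" "order_bounded A t b"
  shows "order_bounded A (s + t) (a + b)"
proof -
  have "pos ((s *\<^sub>R u - a) + (t *\<^sub>R u - b))" "pos ((s *\<^sub>R u + a) + (t *\<^sub>R u + b))"
    using assms by (auto intro!: pos_add simp: order_bounded_iff_pos)
  then show ?thesis
    using assms by (simp add: order_bounded_iff_pos algebra_simps)
qed

lemma order_bounded_minus: "a \<in> V \<Longrightarrow> order_bounded A t (- a) \<longleftrightarrow> order_bounded A t a"
  by (auto simp: order_bounded_iff_pos)

lemma order_bounded_0: "0 \<le> t \<Longrightarrow> order_bounded A t 0"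
  by (simp add: order_bounded_iff_pos pos_scale pos_unit)

lemma order_bounded_all_eq_0:
  assumes "a \<in> V" "\<And>t. t > 0 \<Longrightarrow> order_bounded A t a"
  shows "a = 0"
proof -
  have arch: "leq A b 0" if "b \<in> V" "\<And>t. t > 0 \<Longrightarrow> leq A b (t *\<^sub>R u)" for b
    using ou that by (simp add: order_unit_space_def)
  have "pos (t *\<^sub>R u - a)" "pos (t *\<^sub>R u + a)" if "t > 0" for t
    using assms(2)[OF that] assms(1) by (auto simp: order_bounded_iff_pos)
  then have "leq A a 0" "leq A (- a) 0"
    using assms(1) arch[of a] arch[of "- a"] by (auto simp: leq_iff_pos)
  then show ?thesis
    using pos_antisym[of a] assms(1) by (simp add: leq_iff_pos)
qed

lemma ou_norm_nonneg: "a \<in> V \<Longrightarrow> 0 \<le> ou_norm A a"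
  unfolding ou_norm_def using order_bounded_ex[of a]
  by (intro cInf_greatest) (auto simp: order_bounded_def)

lemma ou_norm_le: "0 < t \<Longrightarrow> order_bounded A t a \<Longrightarrow> ou_norm A a \<le> t"
  unfolding ou_norm_def order_bounded_def
  by (intro cInf_lower) (auto intro!: bdd_belowI[of _ 0])

lemma order_bounded_if_ou_norm_less:
  assumes "a \<in> V" "ou_norm A a < t"
  shows "order_bounded A t a"
proof -
  have ne: "{t. t > 0 \<and> leq A (- (t *\<^sub>R u)) a \<and> leq A a (t *\<^sub>R u)} \<noteq> {}"
    using order_bounded_ex[OF assms(1)] by (auto simp: order_bounded_def)
  obtain s where "s < t" "order_bounded A s a"
    using cInf_lessD[OF ne assms(2)[unfolded ou_norm_def]] by (auto simp: order_bounded_def)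
  then show ?thesis
    using order_bounded_mono assms(1) by simp
qed

lemma ou_norm_eq_0: "a \<in> V \<Longrightarrow> ou_norm A a = 0 \<longleftrightarrow> a = 0"
proof
  assume "a \<in> V" "ou_norm A a = 0"
  then show "a = 0"
    by (intro order_bounded_all_eq_0) (auto intro: order_bounded_if_ou_norm_less)
next
  assume "a = 0"
  then have "ou_norm A a \<le> 0 + e" if "e > 0" for e
    using that by (simp add: ou_norm_le order_bounded_0)
  then show "ou_norm A a = 0"
    using ou_norm_nonneg[of a] \<open>a = 0\<close> field_le_epsilon[of "ou_norm A a" 0] by auto
qed

lemma ou_norm_triangle:
  assumes "a \<in> V" "b \<in> V"
  shows "ou_norm A (a + b) \<le> ou_norm A a + ou_norm A b"
proof (rule field_le_epsilon)
  fix e :: real assume "e > 0"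
  then have "order_bounded A ((ou_norm A a + e / 2) + (ou_norm A b + e / 2)) (a + b)"
    using assms by (intro order_bounded_add order_bounded_if_ou_norm_less) auto
  then show "ou_norm A (a + b) \<le> ou_norm A a + ou_norm A b + e"
    using ou_norm_nonneg[OF assms(1)] ou_norm_nonneg[OF assms(2)] \<open>e > 0\<close>
    by (intro ou_norm_le) (auto simp: algebra_simps)
qed

lemma ou_norm_minus: "a \<in> V \<Longrightarrow> ou_norm A (- a) = ou_norm A a"
  using order_bounded_minus[of a] by (simp add: ou_norm_def order_bounded_def)

sublocale normM: Metric_space V "ou_dist A"
proof
  fix x y z
  show "0 \<le> ou_dist A x y" by (simp add: ou_dist_def ou_norm_nonneg)
  show "ou_dist A x y = ou_dist A y x"
    using ou_norm_minus[of "x - y"] by (simp add: ou_dist_def)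
  show "x \<in> V \<Longrightarrow> y \<in> V \<Longrightarrow> ou_dist A x y = 0 \<longleftrightarrow> x = y"
    by (simp add: ou_dist_def ou_norm_eq_0)
  show "x \<in> V \<Longrightarrow> y \<in> V \<Longrightarrow> z \<in> V \<Longrightarrow> ou_dist A x z \<le> ou_dist A x y + ou_dist A y z"
    using ou_norm_triangle[of "x - y" "y - z"] by (simp add: ou_dist_def)
qed

text \<open>
  Conditions that involve arbitrarily small distances can be read off from the order alone; the
  infimum in the norm disappears. This makes closedness, density and completeness easy to move
  along direct sums and isomorphisms.
\<close>

lemma closure_of_norm_topology:
  assumes "C \<subseteq> V"
  shows "norm_topology A closure_of C = {a \<in> V. \<forall>e>0. \<exists>x\<in>C. order_bounded A e (a - x)}"
proof (intro Collect_cong set_eqI iffI)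
  fix a
  assume "a \<in> norm_topology A closure_of C"
  then have a: "a \<in> V" and ex: "\<And>r. r > 0 \<Longrightarrow> \<exists>x\<in>C. ou_dist A a x < r"
    by (auto simp: norm_topology_def normM.metric_closure_of)
  have "\<exists>x\<in>C. order_bounded A e (a - x)" if "e > 0" for e
    using ex[OF that] a assms
    by (auto simp: ou_dist_def intro!: order_bounded_if_ou_norm_less bexI)
  with a show "a \<in> {a \<in> V. \<forall>e>0. \<exists>x\<in>C. order_bounded A e (a - x)}" by simp
next
  fix a
  assume *: "a \<in> {a \<in> V. \<forall>e>0. \<exists>x\<in>C. order_bounded A e (a - x)}"
  have "\<exists>x\<in>C. x \<in> normM.mball a r" if "r > 0" for r
  proof -
    obtain x where x: "x \<in> C" "order_bounded A (r / 2) (a - x)"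
      using * \<open>r > 0\<close> by (auto dest!: spec[of _ "r / 2"])
    then have "ou_dist A a x \<le> r / 2"
      using \<open>r > 0\<close> * assms ou_norm_le[of "r / 2" "a - x"] by (auto simp: ou_dist_def)
    then show ?thesis
      using x \<open>r > 0\<close> * assms by (auto intro!: bexI[of _ x])
  qed
  then show "a \<in> norm_topology A closure_of C"
    using * by (simp add: norm_topology_def normM.metric_closure_of)
qed

lemma closedin_norm_topology:
  assumes "C \<subseteq> V"
  shows "closedin (norm_topology A) C \<longleftrightarrow>
    (\<forall>a\<in>V. (\<forall>e>0. \<exists>x\<in>C. order_bounded A e (a - x)) \<longrightarrow> a \<in> C)"
proof -
  have "C \<subseteq> norm_topology A closure_of C"
    using assms by (intro closure_of_subset) (simp add: norm_topology_def)
  then show ?thesis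
    unfolding closure_of_eq[symmetric] closure_of_norm_topology[OF assms] by blast
qed

lemma norm_complete_iff:
  "norm_complete A \<longleftrightarrow>
    (\<forall>\<sigma>. (\<forall>n::nat. \<sigma> n \<in> V) \<and> (\<forall>e>0. \<exists>N. \<forall>m\<ge>N. \<forall>n\<ge>N. order_bounded A e (\<sigma> m - \<sigma> n)) \<longrightarrow>
      (\<exists>a\<in>V. \<forall>e>0. \<exists>N. \<forall>n\<ge>N. order_bounded A e (\<sigma> n - a)))"
proof -
  (* A strict norm bound and an order bound imply each other up to a factor, which the
     quantifier over e absorbs. *)
  have small: "(\<forall>e>0. \<exists>N::nat. P N (\<lambda>a. ou_norm A a < e)) \<longleftrightarrow> (\<forall>e>0. \<exists>N. P N (order_bounded A e))"
    if P: "\<And>N Q Q'. P N Q \<Longrightarrow> (\<And>a. a \<in> V \<Longrightarrow> Q a \<Longrightarrow> Q' a) \<Longrightarrow> P N Q'"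
    for P :: "nat \<Rightarrow> ('a \<Rightarrow> bool) \<Rightarrow> bool"
  proof (intro iffI allI impI)
    fix e :: real assume "\<forall>e>0. \<exists>N. P N (\<lambda>a. ou_norm A a < e)" "e > 0"
    then show "\<exists>N. P N (order_bounded A e)" 
      using order_bounded_if_ou_norm_less P by meson
  next
    fix e :: real assume "\<forall>e>0. \<exists>N. P N (order_bounded A e)" "e > 0"
    then obtain N where "P N (order_bounded A (e / 2))" 
      by (meson half_gt_zero)
    then have "P N (\<lambda>a. ou_norm A a < e)"
      by (rule P) (use ou_norm_le[of "e / 2"] \<open>e > 0\<close> in fastforce)
    then show "\<exists>N. P N (\<lambda>a. ou_norm A a < e)" ..
  qed
  have cauchy: "normM.MCauchy \<sigma> \<longleftrightarrow>
      (\<forall>n::nat. \<sigma> n \<in> V) \<and> (\<forall>e>0. \<exists>N. \<forall>m\<ge>N. \<forall>n\<ge>N. order_bounded A e (\<sigma> m - \<sigma> n))" for \<sigma>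
  proof (cases "\<forall>n. \<sigma> n \<in> V")
    case True
    then have "normM.MCauchy \<sigma> \<longleftrightarrow>
        (\<forall>e>0. \<exists>N. \<forall>m\<ge>N. \<forall>n\<ge>N. ou_norm A (\<sigma> m - \<sigma> n) < e)"
      by (auto simp: normM.MCauchy_def ou_dist_def)
    also have "\<dots> \<longleftrightarrow> (\<forall>e>0. \<exists>N. \<forall>m\<ge>N. \<forall>n\<ge>N. order_bounded A e (\<sigma> m - \<sigma> n))"
      using True by (intro small[of "\<lambda>N Q. \<forall>m\<ge>N. \<forall>n\<ge>N. Q (\<sigma> m - \<sigma> n)"]) simp
    finally show ?thesis using True by simp
  qed (auto simp: normM.MCauchy_def)
  have lim: "limitin normM.mtopology \<sigma> a sequentially \<longleftrightarrow>
      a \<in> V \<and> (\<forall>e>0. \<exists>N. \<forall>n\<ge>N. order_bounded A e (\<sigma> n - a))" if "\<forall>n. \<sigma> n \<in> V" for \<sigma> a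
  proof (cases "a \<in> V")
    case True
    then have "limitin normM.mtopology \<sigma> a sequentially \<longleftrightarrow>
        (\<forall>e>0. \<exists>N. \<forall>n\<ge>N. ou_norm A (\<sigma> n - a) < e)"
      using that by (simp add: normM.limit_metric_sequentially ou_dist_def)
    also have "\<dots> \<longleftrightarrow> (\<forall>e>0. \<exists>N. \<forall>n\<ge>N. order_bounded A e (\<sigma> n - a))"
      using True that by (intro small[of "\<lambda>N Q. \<forall>n\<ge>N. Q (\<sigma> n - a)"]) simp
    finally show ?thesis using True by simp
  qed (simp add: normM.limit_metric_sequentially)
  show ?thesis
    unfolding norm_complete_def normM.mcomplete_def cauchy
    using lim by (metis (no_types, lifting))
qed

section \<open>Existence of states\<close>

text \<open>
  By Zorn's lemma there is a maximal convex cone that contains the positive elements but not the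
  negative of the unit. If neither \<open>a\<close> nor \<open>- a\<close> belonged to it, adjoining either one would produce
  the negative unit, and a positive combination of the two relations would already put it into the
  cone. So the cone orders the space totally, every element has a well-defined position among the
  multiples of the unit, and this position is a state.
\<close>

lemma state_exists:
  assumes "u \<noteq> 0"
  shows "states A \<noteq> {}"
proof -
  define cone where "cone P \<longleftrightarrow> P \<subseteq> V \<and> {a \<in> V. pos a} \<subseteq> P \<and> - u \<notin> P \<and>
    (\<forall>x\<in>P. \<forall>y\<in>P. x + y \<in> P) \<and> (\<forall>t\<ge>0. \<forall>x\<in>P. t *\<^sub>R x \<in> P)" for P
  have base: "cone {a \<in> V. pos a}"
    using pos_antisym[of u] pos_unit assms by (auto simp: cone_def pos_add pos_scale)
  have "\<exists>P\<in>Collect cone. \<forall>Q\<in>Collect cone. P \<subseteq> Q \<longrightarrow> Q = P"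
  proof (rule subset_Zorn_nonempty)
    show "Collect cone \<noteq> {}" using base by auto
    fix C assume C: "C \<noteq> {}" "subset.chain (Collect cone) C"
    have mem: "cone P" if "P \<in> C" for P
      using C that by (auto simp: subset.chain_def)
    have "x + y \<in> \<Union> C" if xy: "x \<in> P" "P \<in> C" "y \<in> Q" "Q \<in> C" for x y P Q
    proof -
      have "P \<subseteq> Q \<or> Q \<subseteq> P" using C(2) xy by (auto simp: subset_chain_def)
      then obtain R where "x \<in> R" "y \<in> R" "R \<in> C" using xy by blast
      then show ?thesis
        using mem[of R] unfolding cone_def by blast
    qed
    moreover have "\<Union> C \<subseteq> V" "- u \<notin> \<Union> C" "\<forall>t\<ge>0. \<forall>x\<in>\<Union> C. t *\<^sub>R x \<in> \<Union> C"
      using mem unfolding cone_def by blast+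
    moreover have "{a \<in> V. pos a} \<subseteq> \<Union> C"
      using C(1) mem unfolding cone_def by blast
    ultimately show "\<Union> C \<in> Collect cone"
      unfolding cone_def by blast
  qed
  then obtain P where P: "cone P" and max: "\<And>Q. cone Q \<Longrightarrow> P \<subseteq> Q \<Longrightarrow> Q = P"
    by auto
  have PV: "x \<in> V" if "x \<in> P" for x using P that by (auto simp: cone_def)
  have Ppos: "x \<in> P" if "x \<in> V" "pos x" for x using P that by (auto simp: cone_def)
  have Padd: "x + y \<in> P" if "x \<in> P" "y \<in> P" for x y using P that by (auto simp: cone_def)
  have Pscale: "t *\<^sub>R x \<in> P" if "t \<ge> 0" "x \<in> P" for t x using P that by (auto simp: cone_def)
  have Pu: "t *\<^sub>R u \<notin> P" if "t < 0" for t
  proof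
    assume "t *\<^sub>R u \<in> P"
    then have "(- 1 / t) *\<^sub>R (t *\<^sub>R u) \<in> P"
      using Pscale[of "- 1 / t" "t *\<^sub>R u"] that by (simp only: divide_nonpos_neg)
    then show False using that P by (simp add: cone_def)
  qed
  (* Maximality: the cone generated by P and an outside element must contain -u. *)
  have adjoin: "\<exists>p\<in>P. \<exists>s>0. p + s *\<^sub>R a = - u" if a: "a \<in> V" "a \<notin> P" for a
  proof (rule ccontr)
    assume contra: "\<not> ?thesis"
    define Q where "Q = {p + s *\<^sub>R a | p s. p \<in> P \<and> s \<ge> 0}"
    have PQ: "P \<subseteq> Q" unfolding Q_def by (force intro: exI[of _ "0::real"])
    have aQ: "a \<in> Q"
      unfolding Q_def using Ppos[of 0] by (force intro: exI[of _ "1::real"])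
    have "- u \<notin> Q"
    proof
      assume "- u \<in> Q"
      then obtain p s where "- u = p + s *\<^sub>R a" "p \<in> P" "s \<ge> 0" by (auto simp: Q_def)
      moreover have "- u \<notin> P" using P by (simp add: cone_def)
      ultimately have "s > 0" by (cases "s = 0") auto
      then show False
        using contra \<open>- u = p + s *\<^sub>R a\<close> \<open>p \<in> P\<close> by force
    qed
    moreover have "x + y \<in> Q" if "x \<in> Q" "y \<in> Q" for x y
    proof -
      from that obtain p s q r where "x = p + s *\<^sub>R a" "y = q + r *\<^sub>R a" "p \<in> P" "q \<in> P" "s \<ge> 0" "r \<ge> 0"
        by (auto simp: Q_def)
      then have "x + y = (p + q) + (s + r) *\<^sub>R a" "p + q \<in> P" "s + r \<ge> 0"
        by (auto simp: algebra_simps Padd)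
      then show ?thesis unfolding Q_def by blast
    qed
    moreover have "t *\<^sub>R x \<in> Q" if "t \<ge> 0" "x \<in> Q" for t x
    proof -
      from that obtain p s where "x = p + s *\<^sub>R a" "p \<in> P" "s \<ge> 0" by (auto simp: Q_def)
      then have "t *\<^sub>R x = t *\<^sub>R p + (t * s) *\<^sub>R a" "t *\<^sub>R p \<in> P" "t * s \<ge> 0"
        using that by (auto simp: algebra_simps Pscale)
      then show ?thesis unfolding Q_def by blast
    qed
    moreover have "Q \<subseteq> V" using a PV by (auto simp: Q_def)
    ultimately have "cone Q" using PQ P by (auto simp: cone_def)
    then show False using max[of Q] PQ aQ a by blast
  qed
  have total: "a \<in> P \<or> - a \<in> P" if a: "a \<in> V" for a
  proof (rule ccontr)
    assume "\<not> ?thesis"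
    then obtain p s q r where *: "p \<in> P" "s > 0" "p + s *\<^sub>R a = - u"
        "q \<in> P" "r > 0" "q + r *\<^sub>R (- a) = - u"
      using adjoin[of a] adjoin[of "- a"] a by auto
    have "r *\<^sub>R p + s *\<^sub>R q = r *\<^sub>R (p + s *\<^sub>R a) + s *\<^sub>R (q + r *\<^sub>R (- a))"
      by (simp add: algebra_simps)
    also have "\<dots> = (- (r + s)) *\<^sub>R u"
      unfolding * by (simp add: algebra_simps)
    finally have "(- (r + s)) *\<^sub>R u \<in> P"
      using Padd[OF Pscale[of r p] Pscale[of s q]] * by simp
    then show False using Pu[of "- (r + s)"] * by simp
  qed
  define \<phi> where "\<phi> a = Inf {t. t *\<^sub>R u - a \<in> P}" for a
  have up: "\<phi> a \<le> t" if "a \<in> V" "t *\<^sub>R u - a \<in> P" for a t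
  proof -
    obtain s where s: "order_bounded A s a" using order_bounded_ex[OF \<open>a \<in> V\<close>] by auto
    have "- s \<le> r" if r: "r *\<^sub>R u - a \<in> P" for r
    proof (rule ccontr)
      assume "\<not> ?thesis"
      moreover have "(r *\<^sub>R u - a) + (s *\<^sub>R u + a) \<in> P"
        using s \<open>a \<in> V\<close> by (intro Padd r Ppos[of "s *\<^sub>R u + a"]) (auto simp: order_bounded_iff_pos)
      ultimately show False using Pu[of "r + s"] by (simp add: algebra_simps)
    qed
    then show ?thesis
      unfolding \<phi>_def using that by (intro cInf_lower) (auto intro!: bdd_belowI[of _ "- s"])
  qed
  have low: "t \<le> \<phi> a" if "a \<in> V" "a - t *\<^sub>R u \<in> P" for a t
    unfolding \<phi>_def
  proof (rule cInf_greatest)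
    obtain s where s: "order_bounded A s a" using order_bounded_ex[OF \<open>a \<in> V\<close>] by auto
    then have "s *\<^sub>R u - a \<in> P"
      using \<open>a \<in> V\<close> by (intro Ppos) (auto simp: order_bounded_iff_pos)
    then show "{t. t *\<^sub>R u - a \<in> P} \<noteq> {}" by blast
    fix r assume "r \<in> {t. t *\<^sub>R u - a \<in> P}"
    then have "(a - t *\<^sub>R u) + (r *\<^sub>R u - a) \<in> P" using that by (intro Padd) auto
    then have "(r - t) *\<^sub>R u \<in> P" by (simp add: algebra_simps)
    then show "t \<le> r" using Pu[of "r - t"] by fastforce
  qed
  have gt: "t *\<^sub>R u - a \<in> P" if "a \<in> V" "\<phi> a < t" for a t
    using total[of "t *\<^sub>R u - a"] low[of a t] that by auto
  have lt: "a - t *\<^sub>R u \<in> P" if "a \<in> V" "t < \<phi> a" for a t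
    using total[of "t *\<^sub>R u - a"] up[of a t] that by auto
  have add: "\<phi> (a + b) = \<phi> a + \<phi> b" if "a \<in> V" "b \<in> V" for a b
  proof (rule antisym)
    show "\<phi> (a + b) \<le> \<phi> a + \<phi> b"
    proof (rule field_le_epsilon)
      fix e :: real assume "e > 0"
      then have "((\<phi> a + e / 2) *\<^sub>R u - a) + ((\<phi> b + e / 2) *\<^sub>R u - b) \<in> P"
        using that by (intro Padd gt) auto
      then have "(\<phi> a + \<phi> b + e) *\<^sub>R u - (a + b) \<in> P"
        by (simp add: algebra_simps flip: scaleR_add_left)
      then show "\<phi> (a + b) \<le> \<phi> a + \<phi> b + e" using that by (intro up) auto
    qed
    show "\<phi> a + \<phi> b \<le> \<phi> (a + b)"
    proof (rule field_le_epsilon)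
      fix e :: real assume "e > 0"
      then have "(a - (\<phi> a - e / 2) *\<^sub>R u) + (b - (\<phi> b - e / 2) *\<^sub>R u) \<in> P"
        using that by (intro Padd lt) auto
      then have "(a + b) - (\<phi> a + \<phi> b - e) *\<^sub>R u \<in> P"
        by (simp add: algebra_simps flip: scaleR_add_left)
      then show "\<phi> a + \<phi> b \<le> \<phi> (a + b) + e" using low[of "a + b" "\<phi> a + \<phi> b - e"] that by auto
    qed
  qed
  have zero: "\<phi> 0 = 0" using add[of 0 0] by simp
  have neg: "\<phi> (- a) = - \<phi> a" if "a \<in> V" for a
    using add[of a "- a"] that zero by simp
  have scale_pos: "\<phi> (t *\<^sub>R a) = t * \<phi> a" if "t > 0" "a \<in> V" for t a
  proof (rule antisym)
    show "\<phi> (t *\<^sub>R a) \<le> t * \<phi> a"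
    proof (rule field_le_epsilon)
      fix e :: real assume "e > 0"
      then have "t *\<^sub>R ((\<phi> a + e / t) *\<^sub>R u - a) \<in> P"
        using that by (intro Pscale gt) auto
      then have "(t * \<phi> a + e) *\<^sub>R u - t *\<^sub>R a \<in> P" using that by (simp add: algebra_simps)
      then show "\<phi> (t *\<^sub>R a) \<le> t * \<phi> a + e" using that by (intro up) auto
    qed
    show "t * \<phi> a \<le> \<phi> (t *\<^sub>R a)"
    proof (rule field_le_epsilon)
      fix e :: real assume "e > 0"
      then have "t *\<^sub>R (a - (\<phi> a - e / t) *\<^sub>R u) \<in> P"
        using that by (intro Pscale lt) auto
      then have "t *\<^sub>R a - (t * \<phi> a - e) *\<^sub>R u \<in> P" using that by (simp add: algebra_simps)
      then show "t * \<phi> a \<le> \<phi> (t *\<^sub>R a) + e" using low[of "t *\<^sub>R a" "t * \<phi> a - e"] that by auto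
    qed
  qed
  have scale: "\<phi> (t *\<^sub>R a) = t * \<phi> a" if "a \<in> V" for t a
    using scale_pos[of t a] scale_pos[of "- t" a] neg[of "(- t) *\<^sub>R a"] that zero
    by (cases "t > 0"; cases "t = 0") auto
  have "\<phi> u = 1"
    using up[of u 1] low[of u 1] Ppos[of 0] by auto
  moreover have "0 \<le> \<phi> a" if "a \<in> V" "pos a" for a
    using low[of a 0] Ppos[of a] that by simp
  ultimately have "restrict \<phi> V \<in> states A"
    by (auto simp: states_def lin_on_def add scale pos_def)
  then show ?thesis by blast
qed

end

section \<open>Positive functionals and states\<close>

definition positive_functional :: "'a::real_vector ou_space \<Rightarrow> ('a \<Rightarrow> real) \<Rightarrow> bool" where
  "positive_functional A \<alpha> \<longleftrightarrow> lin_on (carr A) \<alpha> \<and> (\<forall>a\<in>carr A. leq A 0 a \<longrightarrow> 0 \<le> \<alpha> a)"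

lemma states_iff:
  "\<phi> \<in> states A \<longleftrightarrow> \<phi> \<in> extensional (carr A) \<and> positive_functional A \<phi> \<and> \<phi> (ounit A) = 1"
  by (auto simp: states_def positive_functional_def)

lemma positive_functional_state: "\<phi> \<in> states A \<Longrightarrow> positive_functional A \<phi>"
  by (simp add: states_iff)

context ou
begin

lemma functional_add: "positive_functional A \<alpha> \<Longrightarrow> a \<in> V \<Longrightarrow> b \<in> V \<Longrightarrow> \<alpha> (a + b) = \<alpha> a + \<alpha> b"
  and functional_scale: "positive_functional A \<alpha> \<Longrightarrow> a \<in> V \<Longrightarrow> \<alpha> (t *\<^sub>R a) = t * \<alpha> a"
  by (auto simp: positive_functional_def lin_on_def)

lemma functional_minus: "positive_functional A \<alpha> \<Longrightarrow> a \<in> V \<Longrightarrow> \<alpha> (- a) = - \<alpha> a"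
  using functional_scale[of \<alpha> a "-1"] by simp

lemma functional_diff: "positive_functional A \<alpha> \<Longrightarrow> a \<in> V \<Longrightarrow> b \<in> V \<Longrightarrow> \<alpha> (a - b) = \<alpha> a - \<alpha> b"
  using functional_add[of \<alpha> a "- b"] by (simp add: functional_minus)

lemma functional_nonneg: "positive_functional A \<alpha> \<Longrightarrow> a \<in> V \<Longrightarrow> pos a \<Longrightarrow> 0 \<le> \<alpha> a"
  by (simp add: positive_functional_def pos_def)

lemma functional_bound:
  assumes "positive_functional A \<alpha>" "a \<in> V" "order_bounded A t a"
  shows "\<bar>\<alpha> a\<bar> \<le> t * \<alpha> u"
  using functional_nonneg[of \<alpha> "t *\<^sub>R u - a"] functional_nonneg[of \<alpha> "t *\<^sub>R u + a"] assms
  by (simp add: order_bounded_iff_pos functional_add functional_diff functional_scale)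

lemma state_bound: "\<phi> \<in> states A \<Longrightarrow> a \<in> V \<Longrightarrow> order_bounded A t a \<Longrightarrow> \<bar>\<phi> a\<bar> \<le> t"
  using functional_bound[of \<phi> a t] by (simp add: states_iff)

lemma functional_unit_nonneg: "positive_functional A \<alpha> \<Longrightarrow> 0 \<le> \<alpha> u"
  using functional_nonneg[of \<alpha> u] pos_unit by simp

lemma functional_unit_0_eq_0:
  assumes "positive_functional A \<alpha>" "\<alpha> u = 0" "a \<in> V"
  shows "\<alpha> a = 0"
  using order_bounded_ex[OF assms(3)] functional_bound[OF assms(1,3)] assms(2) by auto

lemma normalized_functional_state:
  assumes "positive_functional A \<alpha>" "0 < \<alpha> u"
  shows "(\<lambda>a\<in>V. \<alpha> a / \<alpha> u) \<in> states A"
  using assms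
  by (auto simp: states_iff positive_functional_def lin_on_def add_divide_distrib)

lemma functional_bound_by_states:
  assumes \<alpha>: "positive_functional A \<alpha>" and a: "a \<in> V"
    and C: "\<And>\<phi>. \<phi> \<in> states A \<Longrightarrow> \<bar>\<phi> a\<bar> \<le> C"
  shows "\<bar>\<alpha> a\<bar> \<le> \<alpha> u * C"
proof (cases "\<alpha> u = 0")
  case True
  then show ?thesis using functional_unit_0_eq_0[OF \<alpha> _ a] by simp
next
  case False
  then have pos: "0 < \<alpha> u" using functional_unit_nonneg[OF \<alpha>] by simp
  then have "\<bar>\<alpha> a / \<alpha> u\<bar> \<le> C" using C[OF normalized_functional_state[OF \<alpha>]] a by simp
  then show ?thesis using pos by (simp add: field_simps abs_divide)
qed

lemma state_convex:
  assumes "\<phi> \<in> states A" "\<psi> \<in> states A" "0 \<le> s" "s \<le> 1"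
  shows "(\<lambda>a\<in>V. (1 - s) * \<phi> a + s * \<psi> a) \<in> states A"
  unfolding states_iff positive_functional_def
proof (intro conjI ballI impI)
  fix a assume a: "a \<in> V" "leq A 0 a"
  then have "0 \<le> (1 - s) * \<phi> a + s * \<psi> a"
    using assms by (intro add_nonneg_nonneg mult_nonneg_nonneg) (auto simp: states_def)
  then show "0 \<le> (\<lambda>a\<in>V. (1 - s) * \<phi> a + s * \<psi> a) a" using a by simp
qed (use assms in \<open>auto simp: states_def lin_on_def algebra_simps\<close>)

end

section \<open>The weak* topology and the Monge-Kantorovich metric\<close>

lemma finite_uniform_radius:
  fixes P :: "'b \<Rightarrow> real \<Rightarrow> bool"
  assumes "finite F" "\<And>a. a \<in> F \<Longrightarrow> \<exists>r>0. P a r"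
    and "\<And>a r s. P a r \<Longrightarrow> 0 < s \<Longrightarrow> s \<le> r \<Longrightarrow> P a s"
  shows "\<exists>r>0. \<forall>a\<in>F. P a r"
  using assms(1,2)
proof (induction F rule: finite_induct)
  case empty
  then show ?case by (auto intro: exI[of _ "1::real"])
next
  case (insert x F)
  obtain r where "r > 0" "\<forall>a\<in>F. P a r" using insert by auto
  moreover obtain s where "s > 0" "P x s" using insert.prems[of x] by auto
  ultimately show ?case
    using assms(3) by (intro exI[of _ "min r s"]) (auto intro: assms(3))
qed

lemma openin_weak_star:
  "openin (weak_star A) U \<longleftrightarrow> U \<subseteq> states A \<and>
    (\<forall>\<phi>\<in>U. \<exists>F \<delta>. finite F \<and> F \<subseteq> carr A \<and> 0 < \<delta> \<and>
      (\<forall>\<psi>\<in>states A. (\<forall>a\<in>F. \<bar>\<psi> a - \<phi> a\<bar> < \<delta>) \<longrightarrow> \<psi> \<in> U))"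
    (is "_ \<longleftrightarrow> _ \<and> (\<forall>\<phi>\<in>U. ?nbhd \<phi>)")
proof (intro iffI conjI ballI)
  assume "openin (weak_star A) U"
  then obtain T where T: "openin (product_topology (\<lambda>_. euclideanreal) (carr A)) T" "U = T \<inter> states A"
    by (auto simp: weak_star_def openin_subtopology)
  then show "U \<subseteq> states A" by blast
  fix \<phi> assume "\<phi> \<in> U"
  then have "\<phi> \<in> T" using T by blast
  then obtain W where fin: "finite {i \<in> carr A. W i \<noteq> UNIV}" and op: "\<forall>i\<in>carr A. open (W i)"
    and mem: "\<phi> \<in> Pi\<^sub>E (carr A) W" and sub: "Pi\<^sub>E (carr A) W \<subseteq> T"
    using T(1) unfolding openin_product_topology_alt open_openin[symmetric] topspace_euclidean
    by blast
  have "\<exists>\<delta>>0. \<forall>a\<in>{i \<in> carr A. W i \<noteq> UNIV}. ball (\<phi> a) \<delta> \<subseteq> W a"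
    using fin
  proof (rule finite_uniform_radius)
    fix a assume "a \<in> {i \<in> carr A. W i \<noteq> UNIV}"
    then show "\<exists>r>0. ball (\<phi> a) r \<subseteq> W a"
      using op mem open_contains_ball[of "W a"] by (auto simp: PiE_def Pi_def)
  qed auto
  then obtain \<delta> where \<delta>: "\<delta> > 0" "\<forall>a\<in>{i \<in> carr A. W i \<noteq> UNIV}. ball (\<phi> a) \<delta> \<subseteq> W a" by blast
  have "\<psi> \<in> U" if \<psi>: "\<psi> \<in> states A" "\<forall>a\<in>{i \<in> carr A. W i \<noteq> UNIV}. \<bar>\<psi> a - \<phi> a\<bar> < \<delta>" for \<psi>
  proof -
    have "\<psi> a \<in> W a" if "a \<in> carr A" for a
      using that \<psi>(2) \<delta>(2) by (cases "W a = UNIV") (auto simp: subset_eq dist_real_def abs_minus_commute)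
    then have "\<psi> \<in> Pi\<^sub>E (carr A) W" using \<psi>(1) by (auto simp: states_iff PiE_def)
    then show ?thesis using sub \<psi>(1) T(2) by blast
  qed
  then show "?nbhd \<phi>" using fin \<delta>(1)
    by (intro exI[of _ "{i \<in> carr A. W i \<noteq> UNIV}"] exI[of _ \<delta>]) auto
next
  assume U: "U \<subseteq> states A \<and> (\<forall>\<phi>\<in>U. ?nbhd \<phi>)"
  show "openin (weak_star A) U"
  proof (subst openin_subopen, intro ballI)
    fix \<phi> assume \<phi>: "\<phi> \<in> U"
    then obtain F \<delta> where F: "finite F" "F \<subseteq> carr A" "0 < \<delta>"
      "\<And>\<psi>. \<psi> \<in> states A \<Longrightarrow> (\<forall>a\<in>F. \<bar>\<psi> a - \<phi> a\<bar> < \<delta>) \<Longrightarrow> \<psi> \<in> U"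
      using U by meson
    define W where "W a = (if a \<in> F then ball (\<phi> a) \<delta> else UNIV)" for a
    have "finite {i \<in> carr A. W i \<noteq> UNIV}"
      by (rule finite_subset[OF _ F(1)]) (auto simp: W_def)
    then have "openin (product_topology (\<lambda>_. euclideanreal) (carr A)) (Pi\<^sub>E (carr A) W)"
      by (simp add: openin_PiE_gen W_def)
    then have "openin (weak_star A) (Pi\<^sub>E (carr A) W \<inter> states A)"
      by (auto simp: weak_star_def openin_subtopology)
    moreover have "\<phi> \<in> Pi\<^sub>E (carr A) W \<inter> states A"
      using \<phi> subsetD[OF conjunct1[OF U] \<phi>] F(3) by (simp add: W_def states_iff PiE_def Pi_def)
    moreover have "Pi\<^sub>E (carr A) W \<inter> states A \<subseteq> U"
    proof
      fix \<psi> assume \<psi>: "\<psi> \<in> Pi\<^sub>E (carr A) W \<inter> states A"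
      have "\<bar>\<psi> a - \<phi> a\<bar> < \<delta>" if "a \<in> F" for a
      proof -
        have "\<psi> a \<in> W a" using \<psi> that F(2) by (auto simp: PiE_def Pi_def)
        then show ?thesis using that by (simp add: W_def dist_real_def abs_minus_commute)
      qed
      then show "\<psi> \<in> U" using F(4) \<psi> by blast
    qed
    ultimately show "\<exists>T. openin (weak_star A) T \<and> \<phi> \<in> T \<and> T \<subseteq> U" by blast
  qed
qed

text \<open>
  The first clause says that metric balls are weak* neighbourhoods, the second that evaluations are
  continuous for the metric.
\<close>

lemma mtopology_eq_weak_star_iff:
  assumes "Metric_space (states A) d"
  shows "Metric_space.mtopology (states A) d = weak_star A \<longleftrightarrow>
    (\<forall>\<phi>\<in>states A. \<forall>r>0. \<exists>F \<delta>. finite F \<and> F \<subseteq> carr A \<and> 0 < \<delta> \<and>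
      (\<forall>\<psi>\<in>states A. (\<forall>a\<in>F. \<bar>\<psi> a - \<phi> a\<bar> < \<delta>) \<longrightarrow> d \<phi> \<psi> < r)) \<and>
    (\<forall>\<phi>\<in>states A. \<forall>a\<in>carr A. \<forall>e>0. \<exists>r>0. \<forall>\<psi>\<in>states A. d \<phi> \<psi> < r \<longrightarrow> \<bar>\<psi> a - \<phi> a\<bar> < e)"
    (is "_ \<longleftrightarrow> ?fine \<and> ?coarse")
proof -
  interpret M: Metric_space "states A" d by fact
  show ?thesis
  proof
    assume eq: "M.mtopology = weak_star A"
    have ?fine
    proof (intro ballI allI impI)
      fix \<phi> and r :: real assume *: "\<phi> \<in> states A" "r > 0"
      have "openin (weak_star A) (M.mball \<phi> r)" using eq M.openin_mball by metis
      moreover have "\<phi> \<in> M.mball \<phi> r" using * by simp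
      ultimately obtain F \<delta> where "finite F" "F \<subseteq> carr A" "0 < \<delta>"
        "\<forall>\<psi>\<in>states A. (\<forall>a\<in>F. \<bar>\<psi> a - \<phi> a\<bar> < \<delta>) \<longrightarrow> \<psi> \<in> M.mball \<phi> r"
        unfolding openin_weak_star by blast
      then show "\<exists>F \<delta>. finite F \<and> F \<subseteq> carr A \<and> 0 < \<delta> \<and>
          (\<forall>\<psi>\<in>states A. (\<forall>a\<in>F. \<bar>\<psi> a - \<phi> a\<bar> < \<delta>) \<longrightarrow> d \<phi> \<psi> < r)"
        by (intro exI[of _ F] exI[of _ \<delta>]) simp
    qed
    moreover have ?coarse
    proof (intro ballI allI impI)
      fix \<phi> a and e :: real assume *: "\<phi> \<in> states A" "a \<in> carr A" "e > 0"
      have "openin (weak_star A) {\<psi> \<in> states A. \<bar>\<psi> a - \<phi> a\<bar> < e}"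
        unfolding openin_weak_star
      proof (intro conjI ballI)
        fix \<xi> assume "\<xi> \<in> {\<psi> \<in> states A. \<bar>\<psi> a - \<phi> a\<bar> < e}"
        then show "\<exists>F \<delta>. finite F \<and> F \<subseteq> carr A \<and> 0 < \<delta> \<and>
          (\<forall>\<psi>\<in>states A. (\<forall>a\<in>F. \<bar>\<psi> a - \<xi> a\<bar> < \<delta>) \<longrightarrow> \<psi> \<in> {\<psi> \<in> states A. \<bar>\<psi> a - \<phi> a\<bar> < e})"
          using *(2) by (intro exI[of _ "{a}"] exI[of _ "e - \<bar>\<xi> a - \<phi> a\<bar>"]) auto
      qed auto
      then have "openin M.mtopology {\<psi> \<in> states A. \<bar>\<psi> a - \<phi> a\<bar> < e}" by (simp add: eq)
      then have "\<exists>r>0. M.mball \<phi> r \<subseteq> {\<psi> \<in> states A. \<bar>\<psi> a - \<phi> a\<bar> < e}"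
        using * unfolding M.openin_mtopology by auto
      then show "\<exists>r>0. \<forall>\<psi>\<in>states A. d \<phi> \<psi> < r \<longrightarrow> \<bar>\<psi> a - \<phi> a\<bar> < e"
        using * by (auto simp: subset_iff)
    qed
    ultimately show "?fine \<and> ?coarse" ..
  next
    assume *: "?fine \<and> ?coarse"
    show "M.mtopology = weak_star A"
    proof (rule topology_eq[THEN iffD2], intro allI iffI)
      fix U assume "openin M.mtopology U"
      then have U: "U \<subseteq> states A" "\<And>\<phi>. \<phi> \<in> U \<Longrightarrow> \<exists>r>0. M.mball \<phi> r \<subseteq> U"
        by (auto simp: M.openin_mtopology)
      show "openin (weak_star A) U"
        unfolding openin_weak_star
      proof (intro conjI ballI)
        fix \<phi> assume \<phi>: "\<phi> \<in> U"
        then obtain r where r: "r > 0" "M.mball \<phi> r \<subseteq> U" using U by blast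
        obtain F \<delta> where F: "finite F" "F \<subseteq> carr A" "0 < \<delta>"
            "\<forall>\<psi>\<in>states A. (\<forall>a\<in>F. \<bar>\<psi> a - \<phi> a\<bar> < \<delta>) \<longrightarrow> d \<phi> \<psi> < r"
          using *[THEN conjunct1, THEN bspec, OF subsetD[OF U(1) \<phi>], THEN spec, THEN mp, OF r(1)]
          by blast
        have "\<psi> \<in> U" if "\<psi> \<in> states A" "\<forall>a\<in>F. \<bar>\<psi> a - \<phi> a\<bar> < \<delta>" for \<psi>
        proof -
          have "d \<phi> \<psi> < r" using F(4) that by blast
          then have "\<psi> \<in> M.mball \<phi> r" using that \<phi> U(1) by auto
          then show ?thesis using r(2) by blast
        qed
        then show "\<exists>F \<delta>. finite F \<and> F \<subseteq> carr A \<and> 0 < \<delta> \<and>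
            (\<forall>\<psi>\<in>states A. (\<forall>a\<in>F. \<bar>\<psi> a - \<phi> a\<bar> < \<delta>) \<longrightarrow> \<psi> \<in> U)"
          using F by blast
      qed (rule U(1))
    next
      fix U assume "openin (weak_star A) U"
      then have sub: "U \<subseteq> states A" and U: "\<And>\<phi>. \<phi> \<in> U \<Longrightarrow> \<exists>F \<delta>. finite F \<and> F \<subseteq> carr A \<and> 0 < \<delta> \<and>
          (\<forall>\<psi>\<in>states A. (\<forall>a\<in>F. \<bar>\<psi> a - \<phi> a\<bar> < \<delta>) \<longrightarrow> \<psi> \<in> U)"
        by (auto simp: openin_weak_star)
      have "\<exists>r>0. M.mball \<phi> r \<subseteq> U" if \<phi>: "\<phi> \<in> U" for \<phi>
      proof -
        obtain F \<delta> where F: "finite F" "F \<subseteq> carr A" "0 < \<delta>"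
            "\<forall>\<psi>\<in>states A. (\<forall>a\<in>F. \<bar>\<psi> a - \<phi> a\<bar> < \<delta>) \<longrightarrow> \<psi> \<in> U"
          using U[OF \<phi>] by blast
        have "\<exists>r>0. \<forall>a\<in>F. \<forall>\<psi>\<in>states A. d \<phi> \<psi> < r \<longrightarrow> \<bar>\<psi> a - \<phi> a\<bar> < \<delta>"
        proof (rule finite_uniform_radius[OF F(1)])
          show "\<exists>r>0. \<forall>\<psi>\<in>states A. d \<phi> \<psi> < r \<longrightarrow> \<bar>\<psi> a - \<phi> a\<bar> < \<delta>" if "a \<in> F" for a
            using *[THEN conjunct2, THEN bspec, OF subsetD[OF sub \<phi>], THEN bspec,
                OF subsetD[OF F(2) that], THEN spec, THEN mp, OF F(3)] .
        qed fastforce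
        then obtain r where "r > 0" "\<forall>a\<in>F. \<forall>\<psi>\<in>states A. d \<phi> \<psi> < r \<longrightarrow> \<bar>\<psi> a - \<phi> a\<bar> < \<delta>" by blast
        then show ?thesis using F(4) by (intro exI[of _ r]) auto
      qed
      then show "openin M.mtopology U" using sub by (simp add: M.openin_mtopology)
    qed
  qed
qed

lemma mk_le_iff: "mk A L \<phi> \<psi> \<le> c \<longleftrightarrow> (\<forall>a\<in>carr A. L a \<le> 1 \<longrightarrow> ennreal \<bar>\<phi> a - \<psi> a\<bar> \<le> c)"
  by (auto simp: mk_def SUP_le_iff)

lemma mk_le_ennreal_iff:
  "0 \<le> r \<Longrightarrow> mk A L \<phi> \<psi> \<le> ennreal r \<longleftrightarrow> (\<forall>a\<in>carr A. L a \<le> 1 \<longrightarrow> \<bar>\<phi> a - \<psi> a\<bar> \<le> r)"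
  by (simp add: mk_le_iff)

lemma mk_commute: "mk A L \<phi> \<psi> = mk A L \<psi> \<phi>"
  by (simp add: mk_def abs_minus_commute)

lemma mk_self [simp]: "mk A L \<phi> \<phi> = 0"
  using mk_le_iff[of A L \<phi> \<phi> 0] by simp

lemma mk_triangle: "mk A L \<phi> \<xi> \<le> mk A L \<phi> \<psi> + mk A L \<psi> \<xi>"
  unfolding mk_le_iff
proof (intro ballI impI)
  fix a assume *: "a \<in> carr A" "L a \<le> 1"
  have "ennreal \<bar>\<phi> a - \<xi> a\<bar> \<le> ennreal \<bar>\<phi> a - \<psi> a\<bar> + ennreal \<bar>\<psi> a - \<xi> a\<bar>"
    by (subst ennreal_plus[symmetric]) (auto intro!: ennreal_leI simp del: ennreal_plus)
  also have "\<dots> \<le> mk A L \<phi> \<psi> + mk A L \<psi> \<xi>"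
    using mk_le_iff[of A L \<phi> \<psi> "mk A L \<phi> \<psi>"] mk_le_iff[of A L \<psi> \<xi> "mk A L \<psi> \<xi>"] *
    by (intro add_mono) auto
  finally show "ennreal \<bar>\<phi> a - \<xi> a\<bar> \<le> mk A L \<phi> \<psi> + mk A L \<psi> \<xi>" .
qed

context ou
begin

lemma mk_lipschitz:
  assumes L: "seminorm_on (lip_dom A L) L" and "\<phi> \<in> states A" "\<psi> \<in> states A" "x \<in> V"
    and "L x \<le> ennreal l" "0 < l" "mk A L \<phi> \<psi> \<le> ennreal m" "0 \<le> m"
  shows "\<bar>\<phi> x - \<psi> x\<bar> \<le> l * m"
proof -
  have "x \<in> lip_dom A L"
    using assms(4,5) by (auto simp: lip_dom_def intro: le_less_trans)
  then have "L ((1 / l) *\<^sub>R x) = ennreal (1 / l) * L x"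
    using L \<open>0 < l\<close> by (simp add: seminorm_on_def)
  also have "\<dots> \<le> ennreal (1 / l) * ennreal l" using assms(5) by (intro mult_left_mono) auto
  also have "\<dots> = 1" using \<open>0 < l\<close> by (simp flip: ennreal_mult)
  finally have "\<bar>\<phi> ((1 / l) *\<^sub>R x) - \<psi> ((1 / l) *\<^sub>R x)\<bar> \<le> m"
    using assms by (simp add: mk_le_ennreal_iff)
  also have "\<phi> ((1 / l) *\<^sub>R x) - \<psi> ((1 / l) *\<^sub>R x) = (\<phi> x - \<psi> x) / l"
    using assms by (simp add: functional_scale[OF positive_functional_state] diff_divide_distrib)
  finally show ?thesis using \<open>0 < l\<close> by (simp add: abs_divide field_simps)
qed

text \<open>
  A state has norm one, so approximating an element by one with a finite Lipschitz seminorm costs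
  only the norm of the error. This is why the metric topology always refines the weak* topology.
\<close>

lemma mk_controls_values:
  assumes L: "seminorm_on (lip_dom A L) L"
    and dense: "\<forall>a\<in>V. \<forall>e>0. \<exists>x\<in>lip_dom A L. order_bounded A e (a - x)"
    and a: "a \<in> V" and e: "e > 0"
  shows "\<exists>r>0. \<forall>\<phi>\<in>states A. \<forall>\<psi>\<in>states A. mk A L \<phi> \<psi> \<le> ennreal r \<longrightarrow> \<bar>\<phi> a - \<psi> a\<bar> < e"
proof -
  obtain x where x: "x \<in> V" "L x < \<infinity>" "order_bounded A (e / 4) (a - x)"
    using dense a e by (auto simp: lip_dom_def dest!: bspec[of _ _ a] spec[of _ "e / 4"])
  define l where "l = enn2real (L x) + 1"
  have l: "l > 0" by (auto simp: l_def add_nonneg_pos)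
  have "L x = ennreal (enn2real (L x))" using x(2) by simp
  also have "\<dots> \<le> ennreal l" by (auto simp: l_def intro: ennreal_leI)
  finally have Lx: "L x \<le> ennreal l" .
  have "\<bar>\<phi> a - \<psi> a\<bar> < e" if *: "\<phi> \<in> states A" "\<psi> \<in> states A" "mk A L \<phi> \<psi> \<le> ennreal (e / (4 * l))" for \<phi> \<psi>
  proof -
    have "\<bar>\<phi> x - \<psi> x\<bar> \<le> l * (e / (4 * l))"
      using mk_lipschitz[OF L *(1,2) x(1) Lx l *(3)] l e by simp
    moreover have "\<bar>\<phi> (a - x)\<bar> \<le> e / 4" "\<bar>\<psi> (a - x)\<bar> \<le> e / 4"
      using state_bound[OF *(1) _ x(3)] state_bound[OF *(2) _ x(3)] a x(1) by auto
    moreover have "\<phi> (a - x) = \<phi> a - \<phi> x" "\<psi> (a - x) = \<psi> a - \<psi> x"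
      using * a x(1) by (auto intro: functional_diff positive_functional_state)
    moreover have "l * (e / (4 * l)) = e / 4" using l by simp
    ultimately show ?thesis using e by linarith
  qed
  then show ?thesis using l e by (intro exI[of _ "e / (4 * l)"]) simp
qed

text \<open>
  All topological clauses of a Lip-norm, reduced to inequalities. That the Monge-Kantorovich
  distance is a metric, and that its topology refines the weak* topology, follow from density;
  the only condition that remains is that small weak* neighbourhoods are metrically small.
\<close>

lemma lip_norm_iff:
  "lip_norm A L \<longleftrightarrow>
     subspace (lip_dom A L) \<and>
     (\<forall>a\<in>V. \<forall>e>0. \<exists>x\<in>lip_dom A L. order_bounded A e (a - x)) \<and>
     seminorm_on (lip_dom A L) L \<and>
     {a \<in> V. L a = 0} = range (\<lambda>t. t *\<^sub>R u) \<and>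
     (\<forall>\<phi>\<in>states A. \<forall>\<psi>\<in>states A. mk A L \<phi> \<psi> < \<infinity>) \<and>
     (\<forall>\<phi>\<in>states A. \<forall>r>0. \<exists>F \<delta>. finite F \<and> F \<subseteq> V \<and> 0 < \<delta> \<and>
        (\<forall>\<psi>\<in>states A. (\<forall>a\<in>F. \<bar>\<psi> a - \<phi> a\<bar> < \<delta>) \<longrightarrow> mk A L \<phi> \<psi> \<le> ennreal r)) \<and>
     (\<forall>a\<in>V. (\<forall>e>0. \<exists>x\<in>V. L x \<le> 1 \<and> order_bounded A e (a - x)) \<longrightarrow> L a \<le> 1)"
    (is "_ \<longleftrightarrow> ?sub \<and> ?dense \<and> ?semi \<and> ?ker \<and> ?fin \<and> ?fine \<and> ?closed")
proof -
  let ?d = "\<lambda>\<phi> \<psi>. enn2real (mk A L \<phi> \<psi>)"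
  have dense: "norm_topology A closure_of lip_dom A L = V \<longleftrightarrow> ?dense"
    by (subst closure_of_norm_topology) (auto simp: lip_dom_def)
  have closed: "closedin (norm_topology A) {a \<in> V. L a \<le> 1} \<longleftrightarrow> ?closed"
    by (subst closedin_norm_topology) (auto simp: conj_assoc Bex_def)
  have "Metric_space (states A) ?d \<and> Metric_space.mtopology (states A) ?d = weak_star A \<longleftrightarrow> ?fine"
    if *: ?dense ?semi ?fin
  proof -
    have le: "?d \<phi> \<psi> \<le> r \<longleftrightarrow> mk A L \<phi> \<psi> \<le> ennreal r"
      if "\<phi> \<in> states A" "\<psi> \<in> states A" "0 \<le> r" for \<phi> \<psi> r
    proof -
      have "mk A L \<phi> \<psi> = ennreal (?d \<phi> \<psi>)" using *(3) that by simp
      then show ?thesis using that by (metis ennreal_le_iff)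
    qed
    have metric: "Metric_space (states A) ?d"
    proof
      fix \<phi> \<psi> \<xi>
      show "0 \<le> ?d \<phi> \<psi>" by simp
      show "?d \<phi> \<psi> = ?d \<psi> \<phi>" by (simp add: mk_commute)
      show "?d \<phi> \<psi> = 0 \<longleftrightarrow> \<phi> = \<psi>" if st: "\<phi> \<in> states A" "\<psi> \<in> states A"
      proof
        assume "?d \<phi> \<psi> = 0"
        then have small: "mk A L \<phi> \<psi> \<le> ennreal r" if "r \<ge> 0" for r
          using le[OF st that] that by simp
        have "\<phi> a = \<psi> a" if a: "a \<in> V" for a
        proof (rule ccontr)
          assume "\<phi> a \<noteq> \<psi> a"
          then obtain r where "r > 0" "\<forall>\<phi>\<in>states A. \<forall>\<psi>'\<in>states A.
              mk A L \<phi> \<psi>' \<le> ennreal r \<longrightarrow> \<bar>\<phi> a - \<psi>' a\<bar> < \<bar>\<phi>' a - \<psi> a\<bar>" if "\<phi>' = \<phi>" for \<phi>'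
            using mk_controls_values[OF *(2,1) a, of "\<bar>\<phi> a - \<psi> a\<bar>"] by auto
          then show False using small[of r] st by fastforce
        qed
        then show "\<phi> = \<psi>" using st by (intro extensionalityI[of _ V]) (auto simp: states_iff)
      qed simp
      show "?d \<phi> \<xi> \<le> ?d \<phi> \<psi> + ?d \<psi> \<xi>"
        if st: "\<phi> \<in> states A" "\<psi> \<in> states A" "\<xi> \<in> states A"
      proof -
        have "mk A L \<phi> \<psi> = ennreal (?d \<phi> \<psi>)" "mk A L \<psi> \<xi> = ennreal (?d \<psi> \<xi>)" using *(3) st by auto
        then have "mk A L \<phi> \<xi> \<le> ennreal (?d \<phi> \<psi> + ?d \<psi> \<xi>)"
          using mk_triangle[of A L \<phi> \<xi> \<psi>] by simp
        then show ?thesis using le st by (meson add_nonneg_nonneg enn2real_nonneg)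
      qed
    qed
    have fine: "?fine \<longleftrightarrow> (\<forall>\<phi>\<in>states A. \<forall>r>0. \<exists>F \<delta>. finite F \<and> F \<subseteq> V \<and> 0 < \<delta> \<and>
        (\<forall>\<psi>\<in>states A. (\<forall>a\<in>F. \<bar>\<psi> a - \<phi> a\<bar> < \<delta>) \<longrightarrow> ?d \<phi> \<psi> < r))" (is "_ \<longleftrightarrow> ?fine'")
    proof (intro iffI ballI allI impI)
      fix \<phi> and r :: real assume ?fine "\<phi> \<in> states A" "r > 0"
      then obtain F \<delta> where F: "finite F" "F \<subseteq> V" "0 < \<delta>"
        "\<forall>\<psi>\<in>states A. (\<forall>a\<in>F. \<bar>\<psi> a - \<phi> a\<bar> < \<delta>) \<longrightarrow> mk A L \<phi> \<psi> \<le> ennreal (r / 2)"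
        using \<open>?fine\<close>[THEN bspec, OF \<open>\<phi> \<in> states A\<close>, THEN spec, THEN mp, of "r / 2", OF half_gt_zero[OF \<open>r > 0\<close>]]
        by blast
      then have "?d \<phi> \<psi> < r" if "\<psi> \<in> states A" "\<forall>a\<in>F. \<bar>\<psi> a - \<phi> a\<bar> < \<delta>" for \<psi>
        using le[of \<phi> \<psi> "r / 2"] that \<open>\<phi> \<in> states A\<close> \<open>r > 0\<close> by fastforce
      then show "\<exists>F \<delta>. finite F \<and> F \<subseteq> V \<and> 0 < \<delta> \<and>
        (\<forall>\<psi>\<in>states A. (\<forall>a\<in>F. \<bar>\<psi> a - \<phi> a\<bar> < \<delta>) \<longrightarrow> ?d \<phi> \<psi> < r)" using F by blast
    next
      fix \<phi> and r :: real assume ?fine' "\<phi> \<in> states A" "r > 0"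
      then obtain F \<delta> where F: "finite F" "F \<subseteq> V" "0 < \<delta>"
        "\<forall>\<psi>\<in>states A. (\<forall>a\<in>F. \<bar>\<psi> a - \<phi> a\<bar> < \<delta>) \<longrightarrow> ?d \<phi> \<psi> < r"
        using \<open>?fine'\<close>[THEN bspec, OF \<open>\<phi> \<in> states A\<close>, THEN spec, THEN mp, OF \<open>r > 0\<close>]
        by blast
      then have "mk A L \<phi> \<psi> \<le> ennreal r" if "\<psi> \<in> states A" "\<forall>a\<in>F. \<bar>\<psi> a - \<phi> a\<bar> < \<delta>" for \<psi>
        using le[of \<phi> \<psi> r] that \<open>\<phi> \<in> states A\<close> \<open>r > 0\<close> by fastforce
      then show "\<exists>F \<delta>. finite F \<and> F \<subseteq> V \<and> 0 < \<delta> \<and>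
        (\<forall>\<psi>\<in>states A. (\<forall>a\<in>F. \<bar>\<psi> a - \<phi> a\<bar> < \<delta>) \<longrightarrow> mk A L \<phi> \<psi> \<le> ennreal r)" using F by blast
    qed
    have coarse: "\<forall>\<phi>\<in>states A. \<forall>a\<in>V. \<forall>e>0. \<exists>r>0. \<forall>\<psi>\<in>states A. ?d \<phi> \<psi> < r \<longrightarrow> \<bar>\<psi> a - \<phi> a\<bar> < e"
    proof (intro ballI allI impI)
      fix \<phi> a and e :: real assume **: "\<phi> \<in> states A" "a \<in> V" "e > 0"
      then obtain r where r: "r > 0" "\<forall>\<phi>\<in>states A. \<forall>\<psi>\<in>states A. mk A L \<phi> \<psi> \<le> ennreal r \<longrightarrow> \<bar>\<phi> a - \<psi> a\<bar> < e"
        using mk_controls_values[OF *(2,1)] by blast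
      have "\<bar>\<psi> a - \<phi> a\<bar> < e" if "\<psi> \<in> states A" "?d \<phi> \<psi> < r" for \<psi>
      proof -
        have "mk A L \<phi> \<psi> \<le> ennreal r" using le[of \<phi> \<psi> r] that ** r(1) by simp
        then show ?thesis using r(2) that ** by (simp add: abs_minus_commute)
      qed
      then show "\<exists>r>0. \<forall>\<psi>\<in>states A. ?d \<phi> \<psi> < r \<longrightarrow> \<bar>\<psi> a - \<phi> a\<bar> < e" using r(1) by blast
    qed
    show ?thesis
      using metric coarse unfolding mtopology_eq_weak_star_iff[OF metric] fine by blast
  qed
  then show ?thesis
    unfolding lip_norm_def dense closed by blast
qed

text \<open>
  If the metric induces the weak* topology, then it is bounded: a small weak* neighbourhood of a
  state contains, for a fixed ratio, a homothetic copy of the whole state space, and the metric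
  scales with the homothety.
\<close>

lemma lip_norm_bounded_diameter:
  assumes "lip_norm A L"
  shows "\<exists>C\<ge>0. \<forall>\<phi>\<in>states A. \<forall>\<psi>\<in>states A. \<forall>a\<in>V. L a \<le> 1 \<longrightarrow> \<bar>\<phi> a - \<psi> a\<bar> \<le> C"
proof (cases "states A = {}")
  case True
  then show ?thesis by auto
next
  case False
  then obtain \<omega> where \<omega>: "\<omega> \<in> states A" by blast
  have "\<forall>\<phi>\<in>states A. \<forall>r>0. \<exists>F \<delta>. finite F \<and> F \<subseteq> V \<and> 0 < \<delta> \<and>
        (\<forall>\<psi>\<in>states A. (\<forall>a\<in>F. \<bar>\<psi> a - \<phi> a\<bar> < \<delta>) \<longrightarrow> mk A L \<phi> \<psi> \<le> ennreal r)"
    using assms unfolding lip_norm_iff by (elim conjE) assumption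
  then have "\<exists>F \<delta>. finite F \<and> F \<subseteq> V \<and> 0 < \<delta> \<and>
        (\<forall>\<psi>\<in>states A. (\<forall>a\<in>F. \<bar>\<psi> a - \<omega> a\<bar> < \<delta>) \<longrightarrow> mk A L \<omega> \<psi> \<le> ennreal 1)"
    using \<omega> zero_less_one by blast
  then obtain F \<delta> where F: "finite F" "F \<subseteq> V" "0 < \<delta>"
    "\<And>\<psi>. \<psi> \<in> states A \<Longrightarrow> (\<forall>a\<in>F. \<bar>\<psi> a - \<omega> a\<bar> < \<delta>) \<Longrightarrow> mk A L \<omega> \<psi> \<le> ennreal 1"
    by blast
  (* The homothety of ratio s with centre \<omega> maps all states into the neighbourhood. *)
  have "\<exists>s>0. \<forall>a\<in>F. s \<le> 1 \<and> (\<forall>\<psi>\<in>states A. s * \<bar>\<psi> a - \<omega> a\<bar> < \<delta>)"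
  proof (rule finite_uniform_radius[OF F(1)])
    fix a assume "a \<in> F"
    then obtain t where t: "t > 0" "order_bounded A t a" "a \<in> V" using order_bounded_ex F(2) by blast
    define s where "s = min 1 (\<delta> / (4 * t))"
    have s: "0 < s" "s \<le> 1" "s \<le> \<delta> / (4 * t)" using t F(3) by (auto simp: s_def)
    have "s * \<bar>\<psi> a - \<omega> a\<bar> < \<delta>" if "\<psi> \<in> states A" for \<psi>
    proof -
      have "\<bar>\<psi> a - \<omega> a\<bar> \<le> 2 * t"
        using state_bound[OF that t(3,2)] state_bound[OF \<omega> t(3,2)] by linarith
      then have "s * \<bar>\<psi> a - \<omega> a\<bar> \<le> (\<delta> / (4 * t)) * (2 * t)"
        using s t F(3) by (intro mult_mono) auto
      also have "\<dots> < \<delta>" using t F(3) by simp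
      finally show ?thesis .
    qed
    then show "\<exists>s>0. s \<le> 1 \<and> (\<forall>\<psi>\<in>states A. s * \<bar>\<psi> a - \<omega> a\<bar> < \<delta>)" using s by blast
  next
    fix a and r s :: real
    assume *: "r \<le> 1 \<and> (\<forall>\<psi>\<in>states A. r * \<bar>\<psi> a - \<omega> a\<bar> < \<delta>)" "0 < s" "s \<le> r"
    have "s * \<bar>\<psi> a - \<omega> a\<bar> < \<delta>" if "\<psi> \<in> states A" for \<psi>
      using mult_right_mono[OF *(3), of "\<bar>\<psi> a - \<omega> a\<bar>"] * that by fastforce
    then show "s \<le> 1 \<and> (\<forall>\<psi>\<in>states A. s * \<bar>\<psi> a - \<omega> a\<bar> < \<delta>)" using * by auto
  qed
  then obtain s' where s': "s' > 0" "\<forall>a\<in>F. s' \<le> 1 \<and> (\<forall>\<psi>\<in>states A. s' * \<bar>\<psi> a - \<omega> a\<bar> < \<delta>)" by blast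
  (* The bound s' \<le> 1 is not available if F is empty. *)
  define s where "s = min 1 s'"
  have s: "s > 0" "s \<le> 1" "\<And>a \<psi>. a \<in> F \<Longrightarrow> \<psi> \<in> states A \<Longrightarrow> s * \<bar>\<psi> a - \<omega> a\<bar> < \<delta>"
    using s' by (auto simp: s_def min_def)
  have near: "\<bar>\<psi> a - \<omega> a\<bar> \<le> 1 / s" if *: "\<psi> \<in> states A" "a \<in> V" "L a \<le> 1" for \<psi> a
  proof -
    define \<xi> where "\<xi> = (\<lambda>a\<in>V. (1 - s) * \<omega> a + s * \<psi> a)"
    have \<xi>: "\<xi> \<in> states A" using state_convex[OF \<omega> *(1)] s by (simp add: \<xi>_def)
    have diff: "\<bar>\<xi> b - \<omega> b\<bar> = s * \<bar>\<psi> b - \<omega> b\<bar>" if "b \<in> V" for b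
    proof -
      have "\<xi> b - \<omega> b = s * (\<psi> b - \<omega> b)" using that by (simp add: \<xi>_def algebra_simps)
      then show ?thesis using s by (simp add: abs_mult)
    qed
    have "mk A L \<omega> \<xi> \<le> ennreal 1"
      using F(2) s(3) * by (intro F(4) \<xi>) (auto simp: diff subset_iff)
    then have "\<bar>\<xi> a - \<omega> a\<bar> \<le> 1" using * by (simp add: mk_le_ennreal_iff[of 1, simplified] abs_minus_commute)
    then show ?thesis using s diff[OF *(2)] by (simp add: field_simps)
  qed
  have "\<bar>\<phi> a - \<psi> a\<bar> \<le> 2 / s" if "\<phi> \<in> states A" "\<psi> \<in> states A" "a \<in> V" "L a \<le> 1" for \<phi> \<psi> a
  proof -
    have "\<bar>\<phi> a - \<psi> a\<bar> \<le> \<bar>\<phi> a - \<omega> a\<bar> + \<bar>\<psi> a - \<omega> a\<bar>" by linarith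
    also have "\<dots> \<le> 1 / s + 1 / s" using near that by (intro add_mono) auto
    finally show ?thesis by simp
  qed
  then show ?thesis using s by (intro exI[of _ "2 / s"]) auto
qed

text \<open>
  The two components of a state on a direct sum are positive functionals of variable mass, so the
  comparison of the topologies is needed for these and not only for states. Away from the zero
  functional one normalises. At zero this is impossible, since the normalised functionals need not
  converge; there the bound \<open>C\<close> on the values at states takes over.
\<close>

lemma lip_norm_uniform_on_functionals:
  assumes L: "lip_norm A L" and \<alpha>0: "positive_functional A \<alpha>0" and e: "e > 0" and C: "C \<ge> 0"
  shows "\<exists>F \<delta>. finite F \<and> F \<subseteq> V \<and> 0 < \<delta> \<and>
    (\<forall>\<alpha>. positive_functional A \<alpha> \<longrightarrow> (\<forall>a\<in>F. \<bar>\<alpha> a - \<alpha>0 a\<bar> < \<delta>) \<longrightarrow>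
      (\<forall>a\<in>V. L a \<le> 1 \<longrightarrow> (\<forall>\<phi>\<in>states A. \<bar>\<phi> a\<bar> \<le> C) \<longrightarrow> \<bar>\<alpha> a - \<alpha>0 a\<bar> \<le> e))"
proof (cases "\<alpha>0 u = 0")
  case True
  have "\<bar>\<alpha> a - \<alpha>0 a\<bar> \<le> e" if \<alpha>: "positive_functional A \<alpha>" "\<bar>\<alpha> u - \<alpha>0 u\<bar> < e / (C + 1)"
    and a: "a \<in> V" "\<forall>\<phi>\<in>states A. \<bar>\<phi> a\<bar> \<le> C" for \<alpha> a
  proof -
    have "\<bar>\<alpha> a\<bar> \<le> \<alpha> u * C" using functional_bound_by_states[OF \<alpha>(1) a(1)] a(2) by blast
    also have "\<dots> \<le> (e / (C + 1)) * (C + 1)" using \<alpha>(2) True C e by (intro mult_mono) auto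
    also have "\<dots> = e" using C by simp
    finally show ?thesis using functional_unit_0_eq_0[OF \<alpha>0 True a(1)] by simp
  qed
  then show ?thesis using e C by (intro exI[of _ "{u}"] exI[of _ "e / (C + 1)"]) auto
next
  case False
  define t0 where "t0 = \<alpha>0 u"
  have t0: "t0 > 0" using False functional_unit_nonneg[OF \<alpha>0] by (simp add: t0_def)
  define \<omega> where "\<omega> = (\<lambda>a\<in>V. \<alpha>0 a / t0)"
  have \<omega>: "\<omega> \<in> states A" using normalized_functional_state[OF \<alpha>0] t0 by (simp add: \<omega>_def t0_def)
  have "\<forall>\<phi>\<in>states A. \<forall>r>0. \<exists>F \<delta>. finite F \<and> F \<subseteq> V \<and> 0 < \<delta> \<and>
        (\<forall>\<psi>\<in>states A. (\<forall>a\<in>F. \<bar>\<psi> a - \<phi> a\<bar> < \<delta>) \<longrightarrow> mk A L \<phi> \<psi> \<le> ennreal r)"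
    using L unfolding lip_norm_iff by (elim conjE) assumption
  moreover have r: "e / (2 * t0) > 0" using e t0 by simp
  ultimately have "\<exists>F \<delta>. finite F \<and> F \<subseteq> V \<and> 0 < \<delta> \<and>
        (\<forall>\<psi>\<in>states A. (\<forall>a\<in>F. \<bar>\<psi> a - \<omega> a\<bar> < \<delta>) \<longrightarrow> mk A L \<omega> \<psi> \<le> ennreal (e / (2 * t0)))"
    using \<omega> by blast
  then obtain F \<delta> where F: "finite F" "F \<subseteq> V" "0 < \<delta>"
    "\<And>\<psi>. \<psi> \<in> states A \<Longrightarrow> (\<forall>a\<in>F. \<bar>\<psi> a - \<omega> a\<bar> < \<delta>) \<Longrightarrow> mk A L \<omega> \<psi> \<le> ennreal (e / (2 * t0))"
    by blast
  define M where "M = (\<Sum>a\<in>F. \<bar>\<omega> a\<bar>)"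
  have M: "\<bar>\<omega> a\<bar> \<le> M" if "a \<in> F" for a
    unfolding M_def using F(1) that by (intro member_le_sum) auto
  have M0: "M \<ge> 0" by (simp add: M_def sum_nonneg)
  (* The three bounds keep the value at the unit away from 0, make the normalised functional
     \<delta>-close to \<omega> on F, and make the change of the value at the unit cost at most e / 2. *)
  define \<eta> where "\<eta> = min (t0 / 2) (min (\<delta> * t0 / (4 * (M + 1))) (e / (2 * (C + 1))))"
  have \<eta>: "\<eta> > 0" "\<eta> \<le> t0 / 2" "\<eta> \<le> \<delta> * t0 / (4 * (M + 1))" "\<eta> \<le> e / (2 * (C + 1))"
  proof -
    show "\<eta> > 0" using t0 F(3) M0 e C by (simp add: \<eta>_def)
  qed (unfold \<eta>_def, linarith+)
  have main: "\<bar>\<alpha> a - \<alpha>0 a\<bar> \<le> e" if \<alpha>: "positive_functional A \<alpha>" "\<forall>b\<in>insert u F. \<bar>\<alpha> b - \<alpha>0 b\<bar> < \<eta>"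
    and a: "a \<in> V" "L a \<le> 1" "\<forall>\<phi>\<in>states A. \<bar>\<phi> a\<bar> \<le> C" for \<alpha> a
  proof -
    define t where "t = \<alpha> u"
    have t: "\<bar>t - t0\<bar> < \<eta>" using \<alpha>(2) by (simp add: t_def t0_def)
    then have tpos: "t > t0 / 2" "t > 0" using \<eta> t0 by linarith+
    define \<phi> where "\<phi> = (\<lambda>a\<in>V. \<alpha> a / t)"
    have \<phi>: "\<phi> \<in> states A" using normalized_functional_state[OF \<alpha>(1)] tpos by (simp add: \<phi>_def t_def)
    have "\<bar>\<phi> b - \<omega> b\<bar> < \<delta>" if b: "b \<in> F" for b
    proof -
      have bV: "b \<in> V" using b F(2) by blast
      have "t * (\<phi> b - \<omega> b) = (\<alpha> b - \<alpha>0 b) + (t0 - t) * \<omega> b"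
        using tpos t0 bV by (simp add: \<phi>_def \<omega>_def field_simps)
      then have "t * \<bar>\<phi> b - \<omega> b\<bar> = \<bar>(\<alpha> b - \<alpha>0 b) + (t0 - t) * \<omega> b\<bar>"
        using tpos by (metis abs_mult abs_of_pos)
      also have "\<dots> \<le> \<bar>\<alpha> b - \<alpha>0 b\<bar> + \<bar>t0 - t\<bar> * \<bar>\<omega> b\<bar>"
        by (simp add: abs_triangle_ineq flip: abs_mult)
      also have "\<dots> \<le> \<eta> + \<eta> * M"
        using \<alpha>(2) b t M[OF b] by (intro add_mono mult_mono) auto
      also have "\<dots> = \<eta> * (M + 1)" by (simp add: algebra_simps)
      also have "\<dots> \<le> \<delta> * t0 / (4 * (M + 1)) * (M + 1)" using \<eta>(3) M0 by (intro mult_right_mono) auto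
      also have "\<dots> = \<delta> * t0 / 4" using M0 by (simp add: divide_simps)
      also have "\<dots> < \<delta> * t" using F(3) tpos t0 by simp
      finally show ?thesis using tpos by (simp add: mult.commute)
    qed
    then have "mk A L \<omega> \<phi> \<le> ennreal (e / (2 * t0))" using F(4)[OF \<phi>] by blast
    then have close: "\<bar>\<omega> a - \<phi> a\<bar> \<le> e / (2 * t0)"
      using a r mk_le_ennreal_iff[of "e / (2 * t0)" A L \<omega> \<phi>] by simp
    have "\<alpha> a - \<alpha>0 a = (t - t0) * \<phi> a + t0 * (\<phi> a - \<omega> a)"
      using tpos t0 a by (simp add: \<phi>_def \<omega>_def field_simps)
    then have "\<bar>\<alpha> a - \<alpha>0 a\<bar> \<le> \<bar>t - t0\<bar> * \<bar>\<phi> a\<bar> + t0 * \<bar>\<omega> a - \<phi> a\<bar>"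
      using t0 abs_triangle_ineq[of "(t - t0) * \<phi> a" "t0 * (\<phi> a - \<omega> a)"]
      by (simp add: abs_mult abs_minus_commute)
    also have "\<dots> \<le> e / (2 * (C + 1)) * (C + 1) + t0 * (e / (2 * t0))"
    proof (intro add_mono mult_mono)
      show "\<bar>\<phi> a\<bar> \<le> C + 1" using a(3) \<phi> by fastforce
    qed (use close t \<eta> t0 e C in auto)
    also have "\<dots> = e" using t0 C by (simp add: field_simps)
    finally show ?thesis .
  qed
  show ?thesis
    using F(1,2) \<eta>(1) main by (intro exI[of _ "insert u F"] exI[of _ \<eta>]) auto
qed

end

section \<open>Direct sums\<close>

lemma direct_sum_simps [simp]:
  "carr (direct_sum A B) = carr A \<times> carr B"
  "leq (direct_sum A B) x y \<longleftrightarrow> leq A (fst x) (fst y) \<and> leq B (snd x) (snd y)"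
  "ounit (direct_sum A B) = (ounit A, ounit B)"
  by (auto simp: direct_sum_def)

lemma order_bounded_direct_sum:
  "order_bounded (direct_sum A B) t x \<longleftrightarrow> order_bounded A t (fst x) \<and> order_bounded B t (snd x)"
  by (auto simp: order_bounded_def)

lemma order_unit_space_direct_sum:
  assumes "order_unit_space A" "order_unit_space B"
  shows "order_unit_space (direct_sum A B)"
proof -
  interpret A: ou A by unfold_locales fact
  interpret B: ou B by unfold_locales fact
  have "ordered_vs (direct_sum A B)"
    unfolding ordered_vs_def
  proof (intro conjI ballI allI impI)
    show "subspace (carr (direct_sum A B))"
      using A.subspace_carr B.subspace_carr by (simp add: subspace_Times)
  next
    fix a assume "a \<in> carr (direct_sum A B)"
    then show "leq (direct_sum A B) a a"
      using A.leq_refl B.leq_refl by auto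
  next
    fix a b assume "a \<in> carr (direct_sum A B)" "b \<in> carr (direct_sum A B)"
      "leq (direct_sum A B) a b" "leq (direct_sum A B) b a"
    then show "a = b"
      using A.leq_antisym[THEN bspec, THEN bspec, of "fst a" "fst b"]
        B.leq_antisym[THEN bspec, THEN bspec, of "snd a" "snd b"]
      by (simp add: mem_Times_iff prod_eq_iff)
  next
    fix a b c assume "a \<in> carr (direct_sum A B)" "b \<in> carr (direct_sum A B)" "c \<in> carr (direct_sum A B)"
      "leq (direct_sum A B) a b" "leq (direct_sum A B) b c"
    then show "leq (direct_sum A B) a c"
      using A.leq_trans[rule_format, of "fst a" "fst b" "fst c"]
        B.leq_trans[rule_format, of "snd a" "snd b" "snd c"]
      by (simp add: mem_Times_iff)
  next
    fix a b c assume "a \<in> carr (direct_sum A B)" "b \<in> carr (direct_sum A B)" "c \<in> carr (direct_sum A B)"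
      "leq (direct_sum A B) a b"
    then show "leq (direct_sum A B) (a + c) (b + c)"
      using A.leq_add[rule_format, of "fst a" "fst b" "fst c"]
        B.leq_add[rule_format, of "snd a" "snd b" "snd c"]
      by (simp add: mem_Times_iff)
  next
    fix t :: real and a b assume "0 \<le> t" "a \<in> carr (direct_sum A B)" "b \<in> carr (direct_sum A B)"
      "leq (direct_sum A B) a b"
    then show "leq (direct_sum A B) (t *\<^sub>R a) (t *\<^sub>R b)"
      using A.leq_scale[rule_format, of t "fst a" "fst b"]
        B.leq_scale[rule_format, of t "snd a" "snd b"]
      by (simp add: mem_Times_iff)
  qed
  moreover have "\<exists>t>0. order_bounded (direct_sum A B) t x" if x: "x \<in> carr (direct_sum A B)" for x
  proof -
    obtain s t where "s > 0" "order_bounded A s (fst x)" "t > 0" "order_bounded B t (snd x)"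
      using A.order_bounded_ex[of "fst x"] B.order_bounded_ex[of "snd x"] x by (auto simp: mem_Times_iff)
    then show ?thesis
      using A.order_bounded_mono[of "fst x" s "max s t"] B.order_bounded_mono[of "snd x" t "max s t"] x
      by (intro exI[of _ "max s t"]) (auto simp: order_bounded_direct_sum)
  qed
  moreover have "leq (direct_sum A B) x 0"
    if "x \<in> carr (direct_sum A B)" "\<forall>t>0. leq (direct_sum A B) x (t *\<^sub>R ounit (direct_sum A B))" for x
    using that assms unfolding order_unit_space_def by auto
  ultimately show ?thesis
    unfolding order_unit_space_def order_bounded_def by simp
qed

locale ou_pair = A: ou A + B: ou B
  for A :: "'a::real_vector ou_space" and B :: "'b::real_vector ou_space"
begin

abbreviation "E \<equiv> direct_sum A B"

sublocale E: ou "direct_sum A B"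
  by unfold_locales (rule order_unit_space_direct_sum[OF A.ou B.ou])

lemma norm_complete_direct_sum:
  assumes "norm_complete A" "norm_complete B"
  shows "norm_complete E"
  unfolding E.norm_complete_iff
proof (intro allI impI, elim conjE)
  fix \<sigma> :: "nat \<Rightarrow> 'a \<times> 'b"
  assume \<sigma>: "\<forall>n. \<sigma> n \<in> carr E"
    and cauchy: "\<forall>e>0. \<exists>N. \<forall>m\<ge>N. \<forall>n\<ge>N. order_bounded E e (\<sigma> m - \<sigma> n)"
  have "\<exists>a\<in>carr A. \<forall>e>0. \<exists>N. \<forall>n\<ge>N. order_bounded A e (fst (\<sigma> n) - a)"
    using assms(1)[unfolded A.norm_complete_iff, THEN spec, of "\<lambda>n. fst (\<sigma> n)"] \<sigma> cauchy
    by (auto simp: order_bounded_direct_sum mem_Times_iff) blast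
  then obtain a where a: "a \<in> carr A" "\<forall>e>0. \<exists>N. \<forall>n\<ge>N. order_bounded A e (fst (\<sigma> n) - a)" by blast
  have "\<exists>b\<in>carr B. \<forall>e>0. \<exists>N. \<forall>n\<ge>N. order_bounded B e (snd (\<sigma> n) - b)"
    using assms(2)[unfolded B.norm_complete_iff, THEN spec, of "\<lambda>n. snd (\<sigma> n)"] \<sigma> cauchy
    by (auto simp: order_bounded_direct_sum mem_Times_iff) blast
  then obtain b where b: "b \<in> carr B" "\<forall>e>0. \<exists>N. \<forall>n\<ge>N. order_bounded B e (snd (\<sigma> n) - b)" by blast
  have "\<exists>N. \<forall>n\<ge>N. order_bounded E e (\<sigma> n - (a, b))" if e: "e > 0" for e
  proof -
    obtain M N where "\<forall>n\<ge>M. order_bounded A e (fst (\<sigma> n) - a)" "\<forall>n\<ge>N. order_bounded B e (snd (\<sigma> n) - b)"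
      using a(2) b(2) e by blast
    then show ?thesis by (intro exI[of _ "max M N"]) (auto simp: order_bounded_direct_sum)
  qed
  then show "\<exists>a\<in>carr E. \<forall>e>0. \<exists>N. \<forall>n\<ge>N. order_bounded E e (\<sigma> n - a)"
    using a(1) b(1) by (intro bexI[of _ "(a, b)"]) auto
qed

lemma
  assumes "positive_functional E \<mu>"
  shows functional_left: "positive_functional A (\<lambda>a. \<mu> (a, 0))"
    and functional_right: "positive_functional B (\<lambda>b. \<mu> (0, b))"
    and functional_split: "a \<in> carr A \<Longrightarrow> b \<in> carr B \<Longrightarrow> \<mu> (a, b) = \<mu> (a, 0) + \<mu> (0, b)"
proof -
  have "lin_on (carr A) (\<lambda>a. \<mu> (a, 0))"
    unfolding lin_on_def
  proof (intro conjI ballI allI)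
    fix x y assume "x \<in> carr A" "y \<in> carr A"
    then show "\<mu> (x + y, 0) = \<mu> (x, 0) + \<mu> (y, 0)" using E.functional_add[OF assms, of "(x, 0)" "(y, 0)"] by simp
  next
    fix t x assume "x \<in> carr A"
    then show "\<mu> (t *\<^sub>R x, 0) = t *\<^sub>R \<mu> (x, 0)" using E.functional_scale[OF assms, of "(x, 0)" t] by simp
  qed
  moreover have "0 \<le> \<mu> (a, 0)" if "a \<in> carr A" "leq A 0 a" for a
    using assms that B.pos_0 by (auto simp: positive_functional_def B.pos_def)
  ultimately show "positive_functional A (\<lambda>a. \<mu> (a, 0))" by (simp add: positive_functional_def)
  have "lin_on (carr B) (\<lambda>b. \<mu> (0, b))"
    unfolding lin_on_def
  proof (intro conjI ballI allI)
    fix x y assume "x \<in> carr B" "y \<in> carr B"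
    then show "\<mu> (0, x + y) = \<mu> (0, x) + \<mu> (0, y)" using E.functional_add[OF assms, of "(0, x)" "(0, y)"] by simp
  next
    fix t x assume "x \<in> carr B"
    then show "\<mu> (0, t *\<^sub>R x) = t *\<^sub>R \<mu> (0, x)" using E.functional_scale[OF assms, of "(0, x)" t] by simp
  qed
  moreover have "0 \<le> \<mu> (0, b)" if "b \<in> carr B" "leq B 0 b" for b
    using assms that A.pos_0 by (auto simp: positive_functional_def A.pos_def)
  ultimately show "positive_functional B (\<lambda>b. \<mu> (0, b))" by (simp add: positive_functional_def)
  show "a \<in> carr A \<Longrightarrow> b \<in> carr B \<Longrightarrow> \<mu> (a, b) = \<mu> (a, 0) + \<mu> (0, b)"
    using E.functional_add[OF assms, of "(a, 0)" "(0, b)"] by simp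
qed

lemma state_units: "\<mu> \<in> states E \<Longrightarrow> \<mu> (ounit A, 0) + \<mu> (0, ounit B) = 1"
  using functional_split[of \<mu> "ounit A" "ounit B"] by (simp add: states_iff)

text \<open>The state space of a direct sum is the join of the two state spaces.\<close>

lemma state_direct_sum_cases:
  assumes \<mu>: "\<mu> \<in> states E"
  obtains "\<mu> \<in> pullback_states E A fst" | "\<mu> \<in> pullback_states E B snd"
  | \<phi> \<psi> s where "\<phi> \<in> states A" "\<psi> \<in> states B" "0 \<le> s" "s \<le> 1"
      "\<And>a b. a \<in> carr A \<Longrightarrow> b \<in> carr B \<Longrightarrow> \<mu> (a, b) = (1 - s) * \<phi> a + s * \<psi> b"
proof -
  note pf = positive_functional_state[OF \<mu>]
  define \<alpha> where "\<alpha> = (\<lambda>a. \<mu> (a, 0))"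
  define \<beta> where "\<beta> = (\<lambda>b. \<mu> (0, b))"
  have \<alpha>: "positive_functional A \<alpha>" and \<beta>: "positive_functional B \<beta>"
    using functional_left[OF pf] functional_right[OF pf] by (simp_all add: \<alpha>_def \<beta>_def)
  have split: "\<mu> (a, b) = \<alpha> a + \<beta> b" if "a \<in> carr A" "b \<in> carr B" for a b
    using functional_split[OF pf that] by (simp add: \<alpha>_def \<beta>_def)
  have units: "\<alpha> (ounit A) = 1 - \<beta> (ounit B)" using state_units[OF \<mu>] by (simp add: \<alpha>_def \<beta>_def)
  define \<phi> where "\<phi> = (\<lambda>a\<in>carr A. \<alpha> a / \<alpha> (ounit A))"
  define \<psi> where "\<psi> = (\<lambda>b\<in>carr B. \<beta> b / \<beta> (ounit B))"
  have ext: "\<mu> \<in> extensional (carr A \<times> carr B)" using \<mu> by (simp add: states_iff)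
  consider "\<beta> (ounit B) = 0" | "\<alpha> (ounit A) = 0" | "0 < \<alpha> (ounit A)" "0 < \<beta> (ounit B)"
    using A.functional_unit_nonneg[OF \<alpha>] B.functional_unit_nonneg[OF \<beta>] by linarith
  then show ?thesis
  proof cases
    case 1
    then have "\<phi> \<in> states A" using A.normalized_functional_state[OF \<alpha>] units by (simp add: \<phi>_def)
    moreover have "\<mu> = compose (carr E) \<phi> fst"
      using ext 1 units split B.functional_unit_0_eq_0[OF \<beta> 1]
      by (intro extensionalityI[of _ "carr A \<times> carr B"]) (auto simp: compose_def \<phi>_def)
    ultimately show ?thesis using that(1) by (auto simp: pullback_states_def)
  next
    case 2
    then have "\<psi> \<in> states B" using B.normalized_functional_state[OF \<beta>] units by (simp add: \<psi>_def)
    moreover have "\<mu> = compose (carr E) \<psi> snd"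
      using ext 2 units split A.functional_unit_0_eq_0[OF \<alpha> 2]
      by (intro extensionalityI[of _ "carr A \<times> carr B"]) (auto simp: compose_def \<psi>_def)
    ultimately show ?thesis using that(2) by (auto simp: pullback_states_def)
  next
    case 3
    then have "\<phi> \<in> states A" "\<psi> \<in> states B"
      using A.normalized_functional_state[OF \<alpha>] B.normalized_functional_state[OF \<beta>] by (simp_all add: \<phi>_def \<psi>_def)
    moreover have "\<mu> (a, b) = (1 - \<beta> (ounit B)) * \<phi> a + \<beta> (ounit B) * \<psi> b"
      if "a \<in> carr A" "b \<in> carr B" for a b
      using split[OF that] that 3 by (simp add: \<phi>_def \<psi>_def flip: units)
    ultimately show ?thesis using that(3)[of \<phi> \<psi> "\<beta> (ounit B)"] 3 units by simp
  qed
qed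

end

lemma pullback_states_subset:
  assumes "order_unit_space D" "positive_unital D A \<pi>"
  shows "pullback_states D A \<pi> \<subseteq> states D"
proof -
  interpret D: ou D by unfold_locales fact
  show ?thesis
    using assms(2)
    by (auto simp: pullback_states_def states_def positive_unital_def lin_on_def compose_def Pi_iff)
qed

lemma positive_unital_fst: "positive_unital (direct_sum A B) A fst"
  and positive_unital_snd: "positive_unital (direct_sum A B) B snd"
  by (auto simp: positive_unital_def lin_on_def)

section \<open>The Hausdorff distance and joins\<close>

lemma hausdorff_distance_commute:
  assumes "\<And>x y. d x y = d y x"
  shows "hausdorff_distance d X Y = hausdorff_distance d Y X"
  using assms by (simp add: hausdorff_distance_def max.commute)

text \<open>
  Moving the \<open>Z\<close>-component of a convex combination into \<open>Y\<close> moves the combination by at most as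
  much, so the join of \<open>Y\<close> and \<open>Z\<close> is no farther from \<open>Y\<close> than \<open>Z\<close> is.
\<close>

lemma hausdorff_distance_join_le:
  assumes sub: "Y \<subseteq> X"
    and convex: "\<And>y y' s. y \<in> Y \<Longrightarrow> y' \<in> Y \<Longrightarrow> 0 \<le> s \<Longrightarrow> s \<le> 1 \<Longrightarrow>
      (\<lambda>a\<in>carr A. (1 - s) * y a + s * y' a) \<in> Y"
    and join: "\<And>x. x \<in> X \<Longrightarrow> x \<in> Y \<or> x \<in> Z \<or>
      (\<exists>y\<in>Y. \<exists>z\<in>Z. \<exists>s. 0 \<le> s \<and> s \<le> 1 \<and> (\<forall>a\<in>carr A. x a = (1 - s) * y a + s * z a))"
  shows "hausdorff_distance (mk A L) X Y \<le> hausdorff_distance (mk A L) Y Z"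
proof -
  let ?h = "hausdorff_distance (mk A L) Y Z"
  have Z: "(INF y\<in>Y. mk A L z y) \<le> ?h" if "z \<in> Z" for z
  proof -
    have "(INF y\<in>Y. mk A L z y) = (INF y\<in>Y. mk A L y z)" by (simp add: mk_commute)
    also have "\<dots> \<le> ?h"
      unfolding hausdorff_distance_def using that by (intro max.coboundedI2 SUP_upper)
    finally show ?thesis .
  qed
  have "(INF y\<in>Y. mk A L x y) \<le> ?h" if "x \<in> X" for x
  proof -
    consider "x \<in> Y" | "x \<in> Z" | y z s where "y \<in> Y" "z \<in> Z" "0 \<le> s" "s \<le> 1"
        "\<forall>a\<in>carr A. x a = (1 - s) * y a + s * z a"
      using join[OF \<open>x \<in> X\<close>] by blast
    then show ?thesis
    proof cases
      case 1
      then have "(INF y\<in>Y. mk A L x y) \<le> mk A L x x" by (rule INF_lower)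
      then show ?thesis by simp
    next
      case 2
      then show ?thesis by (rule Z)
    next
      case 3
      have "(INF y\<in>Y. mk A L x y) \<le> mk A L z y'" if y': "y' \<in> Y" for y'
      proof -
        define w where "w = (\<lambda>a\<in>carr A. (1 - s) * y a + s * y' a)"
        have "w \<in> Y" using convex[OF 3(1) y' 3(3,4)] by (simp add: w_def)
        then have "(INF y\<in>Y. mk A L x y) \<le> mk A L x w" by (rule INF_lower)
        also have "\<dots> \<le> mk A L z y'"
          unfolding mk_le_iff
        proof (intro ballI impI)
          fix a assume a: "a \<in> carr A" "L a \<le> 1"
          have "\<bar>x a - w a\<bar> = s * \<bar>z a - y' a\<bar>"
          proof -
            have "x a - w a = s * (z a - y' a)" using 3(5) a by (simp add: w_def algebra_simps)
            then show ?thesis using 3(3) by (simp add: abs_mult)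
          qed
          also have "\<dots> \<le> \<bar>z a - y' a\<bar>" using 3(3,4) by (simp add: mult_left_le_one_le)
          finally have "ennreal \<bar>x a - w a\<bar> \<le> ennreal \<bar>z a - y' a\<bar>" by (rule ennreal_leI)
          also have "\<dots> \<le> mk A L z y'" using a mk_le_iff[of A L z y' "mk A L z y'"] by simp
          finally show "ennreal \<bar>x a - w a\<bar> \<le> mk A L z y'" .
        qed
        finally show ?thesis .
      qed
      then have "(INF y\<in>Y. mk A L x y) \<le> (INF y\<in>Y. mk A L z y)" by (rule INF_greatest)
      also have "\<dots> \<le> ?h" by (rule Z[OF 3(2)])
      finally show ?thesis .
    qed
  qed
  moreover have "(INF x\<in>X. mk A L x y) \<le> ?h" if "y \<in> Y" for y
  proof -
    have "(INF x\<in>X. mk A L x y) \<le> mk A L y y" using sub that by (intro INF_lower) auto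
    then show ?thesis by simp
  qed
  ultimately show ?thesis
    by (subst hausdorff_distance_def) (auto intro: SUP_least)
qed

context ou_pair
begin

lemma pullback_convex:
  assumes "positive_unital E C \<pi>" "order_unit_space C"
    and "y \<in> pullback_states E C \<pi>" "y' \<in> pullback_states E C \<pi>" "0 \<le> s" "s \<le> 1"
  shows "(\<lambda>x\<in>carr E. (1 - s) * y x + s * y' x) \<in> pullback_states E C \<pi>"
proof -
  interpret C: ou C by unfold_locales fact
  obtain \<phi> \<phi>' where *: "\<phi> \<in> states C" "\<phi>' \<in> states C" "y = compose (carr E) \<phi> \<pi>" "y' = compose (carr E) \<phi>' \<pi>"
    using assms(3,4) by (auto simp: pullback_states_def)
  have "(\<lambda>x\<in>carr E. (1 - s) * y x + s * y' x) =
      compose (carr E) (\<lambda>c\<in>carr C. (1 - s) * \<phi> c + s * \<phi>' c) \<pi>"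
    using assms(1) by (auto simp: * compose_def positive_unital_def Pi_iff fun_eq_iff restrict_def)
  then show ?thesis
    using C.state_convex[OF *(1,2) assms(5,6)] by (auto simp: pullback_states_def)
qed

lemma extent_direct_sum_le:
  shows "hausdorff_distance (mk E L) (states E) (pullback_states E A fst) \<le>
      hausdorff_distance (mk E L) (pullback_states E A fst) (pullback_states E B snd)"
    and "hausdorff_distance (mk E L) (states E) (pullback_states E B snd) \<le>
      hausdorff_distance (mk E L) (pullback_states E A fst) (pullback_states E B snd)"
proof -
  let ?Y = "pullback_states E A fst" and ?Z = "pullback_states E B snd"
  have join: "x \<in> ?Y \<or> x \<in> ?Z \<or>
      (\<exists>y\<in>?Y. \<exists>z\<in>?Z. \<exists>s. 0 \<le> s \<and> s \<le> 1 \<and> (\<forall>a\<in>carr E. x a = (1 - s) * y a + s * z a))"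
    if "x \<in> states E" for x
    using that
  proof (cases rule: state_direct_sum_cases)
    case (3 \<phi> \<psi> s)
    have "compose (carr E) \<phi> fst \<in> ?Y" "compose (carr E) \<psi> snd \<in> ?Z"
      using 3 by (auto simp: pullback_states_def)
    moreover have "\<forall>a\<in>carr E. x a = (1 - s) * compose (carr E) \<phi> fst a + s * compose (carr E) \<psi> snd a"
      using 3(5) by (auto simp: compose_def)
    ultimately show ?thesis using 3(3,4) by blast
  qed auto
  show "hausdorff_distance (mk E L) (states E) ?Y \<le> hausdorff_distance (mk E L) ?Y ?Z"
  proof (rule hausdorff_distance_join_le)
    show "?Y \<subseteq> states E" by (rule pullback_states_subset[OF E.ou positive_unital_fst])
  qed (use join pullback_convex[OF positive_unital_fst A.ou] in auto)
  have "hausdorff_distance (mk E L) (states E) ?Z \<le> hausdorff_distance (mk E L) ?Z ?Y"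
  proof (rule hausdorff_distance_join_le)
    show "?Z \<subseteq> states E" by (rule pullback_states_subset[OF E.ou positive_unital_snd])
    fix x assume "x \<in> states E"
    from join[OF this] show "x \<in> ?Z \<or> x \<in> ?Y \<or>
      (\<exists>y\<in>?Z. \<exists>z\<in>?Y. \<exists>s. 0 \<le> s \<and> s \<le> 1 \<and> (\<forall>a\<in>carr E. x a = (1 - s) * y a + s * z a))"
    proof (elim disjE bexE exE conjE)
      fix y z s assume *: "y \<in> ?Y" "z \<in> ?Z" "0 \<le> s" "s \<le> 1" "\<forall>a\<in>carr E. x a = (1 - s) * y a + s * z a"
      then have "0 \<le> 1 - s" "1 - s \<le> 1" "\<forall>a\<in>carr E. x a = (1 - (1 - s)) * z a + (1 - s) * y a" by auto
      then show ?thesis using *(1,2) by blast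
    qed auto
  qed (use pullback_convex[OF positive_unital_snd B.ou] in auto)
  also have "hausdorff_distance (mk E L) ?Z ?Y = hausdorff_distance (mk E L) ?Y ?Z"
    by (rule hausdorff_distance_commute) (rule mk_commute)
  finally show "hausdorff_distance (mk E L) (states E) ?Z \<le> hausdorff_distance (mk E L) ?Y ?Z" .
qed

end

section \<open>Isomorphic copies\<close>

text \<open>The order is read off through \<open>g\<close>, which is meant to be a left inverse of \<open>j\<close>.\<close>

definition space_copy :: "('a \<Rightarrow> 'c) \<Rightarrow> ('c \<Rightarrow> 'a) \<Rightarrow> 'a ou_space \<Rightarrow> 'c ou_space" where
  "space_copy j g A = \<lparr>carr = j ` carr A, leq = (\<lambda>x y. leq A (g x) (g y)), ounit = j (ounit A)\<rparr>"

lemma space_copy_simps [simp]: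
  "carr (space_copy j g A) = j ` carr A"
  "leq (space_copy j g A) x y \<longleftrightarrow> leq A (g x) (g y)"
  "ounit (space_copy j g A) = j (ounit A)"
  by (auto simp: space_copy_def)

locale ou_copy = ou A for A :: "'a::real_vector ou_space" +
  fixes j :: "'a \<Rightarrow> 'c::real_vector" and g :: "'c \<Rightarrow> 'a"
  assumes lin_j: "linear j" and lin_g: "linear g" and gj [simp]: "g (j x) = x"
begin

abbreviation "M \<equiv> space_copy j g A"

lemmas j_simps = linear_add[OF lin_j] linear_diff[OF lin_j] linear_scale[OF lin_j] linear_0[OF lin_j]
lemmas g_simps = linear_add[OF lin_g] linear_diff[OF lin_g] linear_scale[OF lin_g] linear_0[OF lin_g]
  linear_neg[OF lin_g]

lemma order_unit_space_copy: "order_unit_space M"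
  unfolding order_unit_space_def ordered_vs_def
proof (intro conjI ballI allI impI)
  show "subspace (carr M)" using linear_subspace_image[OF lin_j subspace_carr] by simp
next
  fix a assume "a \<in> carr M" then show "leq M a a" using leq_refl by auto
next
  fix a b assume "a \<in> carr M" "b \<in> carr M" "leq M a b" "leq M b a"
  then show "a = b" using leq_antisym[THEN bspec, THEN bspec, of "g a" "g b"] by auto
next
  fix a b c assume "a \<in> carr M" "b \<in> carr M" "c \<in> carr M" "leq M a b" "leq M b c"
  then show "leq M a c" using leq_trans[rule_format, of "g a" "g b" "g c"] by auto
next
  fix a b c assume "a \<in> carr M" "b \<in> carr M" "c \<in> carr M" "leq M a b"
  then show "leq M (a + c) (b + c)"
    using leq_add[rule_format, of "g a" "g b" "g c"] by (auto simp: g_simps)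
next
  fix t :: real and a b assume "0 \<le> t" "a \<in> carr M" "b \<in> carr M" "leq M a b"
  then show "leq M (t *\<^sub>R a) (t *\<^sub>R b)"
    using leq_scale[rule_format, of t "g a" "g b"] by (auto simp: g_simps)
next
  show "ounit M \<in> carr M" by simp
next
  fix a assume "a \<in> carr M"
  then show "\<exists>t>0. leq M (- (t *\<^sub>R ounit M)) a \<and> leq M a (t *\<^sub>R ounit M)"
    using order_bounded_ex[of "g a"] by (auto simp: g_simps order_bounded_def)
next
  fix a assume "a \<in> carr M" "\<forall>t>0. leq M a (t *\<^sub>R ounit M)"
  then show "leq M a 0" using ou by (auto simp: g_simps order_unit_space_def)
qed

sublocale M: ou M
  by unfold_locales (rule order_unit_space_copy)

lemma order_bounded_copy: "order_bounded M t x \<longleftrightarrow> order_bounded A t (g x)"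
  by (simp add: order_bounded_def g_simps)

lemma norm_complete_copy:
  assumes "norm_complete A"
  shows "norm_complete M"
  unfolding M.norm_complete_iff
proof (intro allI impI, elim conjE)
  fix \<sigma> :: "nat \<Rightarrow> 'c"
  assume \<sigma>: "\<forall>n. \<sigma> n \<in> carr M"
    and cauchy: "\<forall>e>0. \<exists>N. \<forall>m\<ge>N. \<forall>n\<ge>N. order_bounded M e (\<sigma> m - \<sigma> n)"
  have "\<forall>n. g (\<sigma> n) \<in> V" using \<sigma> by (metis gj imageE space_copy_simps(1))
  then have "\<exists>a\<in>V. \<forall>e>0. \<exists>N. \<forall>n\<ge>N. order_bounded A e (g (\<sigma> n) - a)"
    using assms[unfolded norm_complete_iff, THEN spec, of "\<lambda>n. g (\<sigma> n)"] cauchy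
    by (simp add: order_bounded_copy g_simps)
  then show "\<exists>a\<in>carr M. \<forall>e>0. \<exists>N. \<forall>n\<ge>N. order_bounded M e (\<sigma> n - a)"
    by (auto simp: order_bounded_copy g_simps)
qed

abbreviation push :: "('a \<Rightarrow> real) \<Rightarrow> 'c \<Rightarrow> real" where
  "push \<phi> \<equiv> compose (carr M) \<phi> g"

lemma mk_push: "mk M (L \<circ> g) (push \<phi>) (push \<psi>) = mk A L \<phi> \<psi>"
proof -
  have "{a \<in> carr M. (L \<circ> g) a \<le> 1} = j ` {a \<in> V. L a \<le> 1}" by auto
  then show ?thesis by (auto simp: mk_def compose_def image_image intro!: SUP_cong)
qed

lemma push_states: "states M = push ` states A"
proof (intro equalityI subsetI)
  fix \<phi> assume \<phi>: "\<phi> \<in> states M"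
  have "compose V \<phi> j \<in> states A"
    using \<phi> by (auto simp: states_def compose_def lin_on_def j_simps g_simps)
  moreover have "\<phi> = push (compose V \<phi> j)"
    using \<phi> by (intro extensionalityI[of _ "carr M"]) (auto simp: states_def compose_def)
  ultimately show "\<phi> \<in> push ` states A" by blast
next
  fix \<phi> assume "\<phi> \<in> push ` states A"
  then obtain \<psi> where \<psi>: "\<psi> \<in> states A" "\<phi> = push \<psi>" by blast
  show "\<phi> \<in> states M"
    unfolding states_def mem_Collect_eq
  proof (intro CollectI conjI ballI impI)
    show "\<phi> \<in> extensional (carr M)" by (simp add: \<psi>)
    have "x + y \<in> carr M" "t *\<^sub>R x \<in> carr M" if "x \<in> carr M" "y \<in> carr M" for x y t
      using that M.subspace_carr by (auto simp del: space_copy_simps)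
    then show "lin_on (carr M) \<phi>"
      using \<psi>(1) unfolding lin_on_def
      by (auto simp: \<psi>(2) compose_def g_simps states_def lin_on_def)
  qed (use \<psi> in \<open>auto simp: states_def compose_def g_simps\<close>)
qed

lemma pullback_states_copy: "pullback_states M C (\<pi> \<circ> g) = push ` pullback_states A C \<pi>"
  unfolding pullback_states_def image_image
  by (intro image_cong refl) (auto simp: compose_def fun_eq_iff)

lemma hausdorff_distance_push:
  "hausdorff_distance (mk M (L \<circ> g)) (push ` X) (push ` Y) = hausdorff_distance (mk A L) X Y"
  by (simp add: hausdorff_distance_def image_image mk_push del: space_copy_simps)

lemma lip_norm_copy:
  assumes "lip_norm A L"
  shows "lip_norm M (L \<circ> g)"
proof -
  have sub: "subspace (lip_dom A L)"
    and dense: "\<forall>a\<in>V. \<forall>e>0. \<exists>x\<in>lip_dom A L. order_bounded A e (a - x)"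
    and semi: "seminorm_on (lip_dom A L) L"
    and ker: "{a \<in> V. L a = 0} = range (\<lambda>t. t *\<^sub>R u)"
    and fin: "\<forall>\<phi>\<in>states A. \<forall>\<psi>\<in>states A. mk A L \<phi> \<psi> < \<infinity>"
    and fine: "\<forall>\<phi>\<in>states A. \<forall>r>0. \<exists>F \<delta>. finite F \<and> F \<subseteq> V \<and> 0 < \<delta> \<and>
        (\<forall>\<psi>\<in>states A. (\<forall>a\<in>F. \<bar>\<psi> a - \<phi> a\<bar> < \<delta>) \<longrightarrow> mk A L \<phi> \<psi> \<le> ennreal r)"
    and closed: "\<forall>a\<in>V. (\<forall>e>0. \<exists>x\<in>V. L x \<le> 1 \<and> order_bounded A e (a - x)) \<longrightarrow> L a \<le> 1"
    using assms unfolding lip_norm_iff by auto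
  have dom: "lip_dom M (L \<circ> g) = j ` lip_dom A L" by (auto simp: lip_dom_def)
  show ?thesis
    unfolding M.lip_norm_iff
  proof (intro conjI)
    show "subspace (lip_dom M (L \<circ> g))" unfolding dom by (rule linear_subspace_image[OF lin_j sub])
    show "\<forall>a\<in>carr M. \<forall>e>0. \<exists>x\<in>lip_dom M (L \<circ> g). order_bounded M e (a - x)"
      using dense unfolding dom by (auto simp: order_bounded_copy g_simps)
    show "seminorm_on (lip_dom M (L \<circ> g)) (L \<circ> g)"
      using semi unfolding dom seminorm_on_def by (auto simp: g_simps)
    have "{a \<in> carr M. (L \<circ> g) a = 0} = j ` {a \<in> V. L a = 0}" by auto
    then show "{a \<in> carr M. (L \<circ> g) a = 0} = range (\<lambda>t. t *\<^sub>R ounit M)"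
      by (simp add: ker image_image j_simps)
    show "\<forall>\<phi>\<in>states M. \<forall>\<psi>\<in>states M. mk M (L \<circ> g) \<phi> \<psi> < \<infinity>"
      using fin by (simp add: push_states mk_push del: space_copy_simps)
    show "\<forall>\<phi>\<in>states M. \<forall>r>0. \<exists>F \<delta>. finite F \<and> F \<subseteq> carr M \<and> 0 < \<delta> \<and>
        (\<forall>\<psi>\<in>states M. (\<forall>a\<in>F. \<bar>\<psi> a - \<phi> a\<bar> < \<delta>) \<longrightarrow> mk M (L \<circ> g) \<phi> \<psi> \<le> ennreal r)"
      unfolding push_states ball_simps mk_push
    proof (intro ballI allI impI)
      fix \<phi> and r :: real assume "\<phi> \<in> states A" "0 < r"
      then obtain F \<delta> where F: "finite F" "F \<subseteq> V" "0 < \<delta>"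
        "\<forall>\<psi>\<in>states A. (\<forall>a\<in>F. \<bar>\<psi> a - \<phi> a\<bar> < \<delta>) \<longrightarrow> mk A L \<phi> \<psi> \<le> ennreal r"
        using fine[THEN bspec, THEN spec, THEN mp, of \<phi> r] by blast
      have "push \<psi> (j a) = \<psi> a" if "a \<in> F" for \<psi> a
        using that F(2) by (auto simp: compose_def)
      then have "\<forall>\<psi>\<in>states A. (\<forall>a\<in>j ` F. \<bar>push \<psi> a - push \<phi> a\<bar> < \<delta>) \<longrightarrow> mk A L \<phi> \<psi> \<le> ennreal r"
        using F(4) by (simp del: space_copy_simps)
      then show "\<exists>F \<delta>. finite F \<and> F \<subseteq> carr M \<and> 0 < \<delta> \<and>
          (\<forall>\<psi>\<in>states A. (\<forall>a\<in>F. \<bar>push \<psi> a - push \<phi> a\<bar> < \<delta>) \<longrightarrow> mk A L \<phi> \<psi> \<le> ennreal r)"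
        using F by (intro exI[of _ "j ` F"] exI[of _ \<delta>]) auto
    qed
    show "\<forall>a\<in>carr M. (\<forall>e>0. \<exists>x\<in>carr M. (L \<circ> g) x \<le> 1 \<and> order_bounded M e (a - x)) \<longrightarrow> (L \<circ> g) a \<le> 1"
      using closed by (auto simp: order_bounded_copy g_simps)
  qed
qed

end

section \<open>Bridge seminorms\<close>

text \<open>
  A pair lies in the unit ball iff both entries lie in the given unit balls and no state of \<open>A\<close>
  separates its value from that of a state of \<open>B\<close> by more than the prescribed number \<open>k\<close>. Thus
  \<open>k\<close> is built in as an upper bound for the distance between the two states in the direct sum.
\<close>

definition bridge_lip ::
  "'a::real_vector ou_space \<Rightarrow> ('a \<Rightarrow> ennreal) \<Rightarrow> 'b::real_vector ou_space \<Rightarrow> ('b \<Rightarrow> ennreal) \<Rightarrow>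
   (('a \<Rightarrow> real) \<Rightarrow> ('b \<Rightarrow> real) \<Rightarrow> real) \<Rightarrow> 'a \<times> 'b \<Rightarrow> ennreal" where
  "bridge_lip A LA B LB k x = max (LA (fst x)) (max (LB (snd x))
     (SUP \<phi>\<in>states A. SUP \<psi>\<in>states B. ennreal (\<bar>\<phi> (fst x) - \<psi> (snd x)\<bar> / k \<phi> \<psi>)))"

lemma bridge_lip_le_iff:
  "bridge_lip A LA B LB k x \<le> c \<longleftrightarrow> LA (fst x) \<le> c \<and> LB (snd x) \<le> c \<and>
    (\<forall>\<phi>\<in>states A. \<forall>\<psi>\<in>states B. ennreal (\<bar>\<phi> (fst x) - \<psi> (snd x)\<bar> / k \<phi> \<psi>) \<le> c)"
  by (auto simp: bridge_lip_def SUP_le_iff)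

lemma bridge_lip_ge:
  shows "LA (fst x) \<le> bridge_lip A LA B LB k x" "LB (snd x) \<le> bridge_lip A LA B LB k x"
    and "\<phi> \<in> states A \<Longrightarrow> \<psi> \<in> states B \<Longrightarrow>
      ennreal (\<bar>\<phi> (fst x) - \<psi> (snd x)\<bar> / k \<phi> \<psi>) \<le> bridge_lip A LA B LB k x"
  using bridge_lip_le_iff[of A LA B LB k x "bridge_lip A LA B LB k x"] by auto

lemma seminorm_onI:
  assumes V: "subspace V"
    and add: "\<And>x y. x \<in> V \<Longrightarrow> y \<in> V \<Longrightarrow> L (x + y) \<le> L x + L y"
    and scale: "\<And>t x. x \<in> V \<Longrightarrow> L (t *\<^sub>R x) \<le> ennreal \<bar>t\<bar> * L x"
  shows "seminorm_on V L"
  unfolding seminorm_on_def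
proof (intro conjI ballI allI add)
  fix t x assume x: "x \<in> V"
  show "L (t *\<^sub>R x) = ennreal \<bar>t\<bar> * L x"
  proof (cases "t = 0")
    case True
    then show ?thesis using scale[OF x, of 0] by simp
  next
    case False
    have "ennreal \<bar>t\<bar> * L x = ennreal \<bar>t\<bar> * L ((1 / t) *\<^sub>R (t *\<^sub>R x))" using False by simp
    also have "\<dots> \<le> ennreal \<bar>t\<bar> * (ennreal \<bar>1 / t\<bar> * L (t *\<^sub>R x))"
      using V x by (intro mult_left_mono scale) (auto simp: subspace_scale)
    also have "\<dots> = L (t *\<^sub>R x)"
      using False by (simp flip: mult.assoc ennreal_mult add: abs_divide)
    finally show ?thesis using scale[OF x, of t] by (rule antisym[rotated])
  qed
qed

context ou
begin

lemma seminorm_unit_shift: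
  assumes "lip_norm A L" "a \<in> V" "L a \<le> 1"
  shows "L (a - c *\<^sub>R u) \<le> 1"
proof -
  have ker: "{a \<in> V. L a = 0} = range (\<lambda>t. t *\<^sub>R u)" and semi: "seminorm_on (lip_dom A L) L"
    using assms(1) unfolding lip_norm_iff by auto
  have "L ((- c) *\<^sub>R u) = 0" using ker by blast
  moreover from this have "a \<in> lip_dom A L" "(- c) *\<^sub>R u \<in> lip_dom A L"
    using assms(2,3) by (auto simp: lip_dom_def intro: le_less_trans simp del: scaleR_minus_left)
  then have "L (a + (- c) *\<^sub>R u) \<le> L a + L ((- c) *\<^sub>R u)"
    using semi unfolding seminorm_on_def by blast
  ultimately show ?thesis using assms(3) by simp
qed

end

context ou_pair
begin

text \<open>
  The lower bound on \<open>k\<close> keeps the third term finite on pairs of elements of finite seminorm, so the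
  domain stays dense. The upper bound confines the unit ball, modulo multiples of the unit, to elements on which
  all states are uniformly bounded; the weak* condition then reduces to the two summands, applied to
  the two components of a state. A pair of seminorm zero consists of multiples of the two units, and
  evaluation at states, which exist as soon as the units are nonzero, shows that the scalars agree.
\<close>

lemma lip_norm_bridge:
  assumes LA: "lip_norm A LA" and LB: "lip_norm B LB"
    and e: "\<epsilon> > 0" and k: "\<And>\<phi> \<psi>. \<phi> \<in> states A \<Longrightarrow> \<psi> \<in> states B \<Longrightarrow> \<epsilon> \<le> k \<phi> \<psi> \<and> k \<phi> \<psi> \<le> K"
  shows "lip_norm E (bridge_lip A LA B LB k)"
proof -
  let ?L = "bridge_lip A LA B LB k"
  have A: "subspace (lip_dom A LA)"
    "\<forall>a\<in>carr A. \<forall>e>0. \<exists>x\<in>lip_dom A LA. order_bounded A e (a - x)"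
    "seminorm_on (lip_dom A LA) LA"
    "{a \<in> carr A. LA a = 0} = range (\<lambda>t. t *\<^sub>R ounit A)"
    "\<forall>a\<in>carr A. (\<forall>e>0. \<exists>x\<in>carr A. LA x \<le> 1 \<and> order_bounded A e (a - x)) \<longrightarrow> LA a \<le> 1"
    using LA unfolding A.lip_norm_iff by auto
  have B: "subspace (lip_dom B LB)"
    "\<forall>a\<in>carr B. \<forall>e>0. \<exists>x\<in>lip_dom B LB. order_bounded B e (a - x)"
    "seminorm_on (lip_dom B LB) LB"
    "{a \<in> carr B. LB a = 0} = range (\<lambda>t. t *\<^sub>R ounit B)"
    "\<forall>a\<in>carr B. (\<forall>e>0. \<exists>x\<in>carr B. LB x \<le> 1 \<and> order_bounded B e (a - x)) \<longrightarrow> LB a \<le> 1"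
    using LB unfolding B.lip_norm_iff by auto
  have kpos: "k \<phi> \<psi> > 0" if "\<phi> \<in> states A" "\<psi> \<in> states B" for \<phi> \<psi>
    using k[OF that] e by linarith
  have le1: "?L (a, b) \<le> 1 \<longleftrightarrow> LA a \<le> 1 \<and> LB b \<le> 1 \<and> (\<forall>\<phi>\<in>states A. \<forall>\<psi>\<in>states B. \<bar>\<phi> a - \<psi> b\<bar> \<le> k \<phi> \<psi>)" for a b
    using kpos by (simp add: bridge_lip_le_iff flip: ennreal_1)
  have dom: "lip_dom E ?L = lip_dom A LA \<times> lip_dom B LB"
  proof (intro equalityI subsetI)
    fix x assume "x \<in> lip_dom E ?L"
    then show "x \<in> lip_dom A LA \<times> lip_dom B LB"
      using bridge_lip_ge(1)[of LA x A B LB k] bridge_lip_ge(2)[of LB x A LA B k]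
      by (auto simp: lip_dom_def mem_Times_iff intro: le_less_trans)
  next
    fix x assume x: "x \<in> lip_dom A LA \<times> lip_dom B LB"
    then have xV: "fst x \<in> carr A" "snd x \<in> carr B" by (auto simp: lip_dom_def)
    obtain s t where st: "s > 0" "order_bounded A s (fst x)" "t > 0" "order_bounded B t (snd x)"
      using A.order_bounded_ex[OF xV(1)] B.order_bounded_ex[OF xV(2)] by blast
    have "ennreal (\<bar>\<phi> (fst x) - \<psi> (snd x)\<bar> / k \<phi> \<psi>) \<le> ennreal ((s + t) / \<epsilon>)"
      if "\<phi> \<in> states A" "\<psi> \<in> states B" for \<phi> \<psi>
    proof (intro ennreal_leI frac_le)
      show "\<bar>\<phi> (fst x) - \<psi> (snd x)\<bar> \<le> s + t"
        using A.state_bound[OF that(1) _ st(2)] B.state_bound[OF that(2) _ st(4)] x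
        by (auto simp: lip_dom_def)
    qed (use k[OF that] e st in auto)
    then have "?L x \<le> max (LA (fst x)) (max (LB (snd x)) (ennreal ((s + t) / \<epsilon>)))"
      unfolding bridge_lip_def by (intro max.mono order_refl SUP_least)
    also have "\<dots> < \<infinity>" using x by (auto simp: lip_dom_def)
    finally show "x \<in> lip_dom E ?L" using x by (auto simp: lip_dom_def)
  qed
  have sub: "subspace (lip_dom E ?L)" unfolding dom using A(1) B(1) by (rule subspace_Times)
  have semi: "seminorm_on (lip_dom E ?L) ?L"
  proof (rule seminorm_onI[OF sub])
    fix x y assume xy: "x \<in> lip_dom E ?L" "y \<in> lip_dom E ?L"
    show "?L (x + y) \<le> ?L x + ?L y"
      unfolding bridge_lip_le_iff
    proof (intro conjI ballI)
      have "LA (fst (x + y)) \<le> LA (fst x) + LA (fst y)"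
        using A(3) xy unfolding dom seminorm_on_def by (auto simp: mem_Times_iff)
      also have "\<dots> \<le> ?L x + ?L y" by (intro add_mono bridge_lip_ge)
      finally show "LA (fst (x + y)) \<le> ?L x + ?L y" .
      have "LB (snd (x + y)) \<le> LB (snd x) + LB (snd y)"
        using B(3) xy unfolding dom seminorm_on_def by (auto simp: mem_Times_iff)
      also have "\<dots> \<le> ?L x + ?L y" by (intro add_mono bridge_lip_ge)
      finally show "LB (snd (x + y)) \<le> ?L x + ?L y" .
      fix \<phi> \<psi> assume st: "\<phi> \<in> states A" "\<psi> \<in> states B"
      have "\<phi> (fst (x + y)) - \<psi> (snd (x + y)) = (\<phi> (fst x) - \<psi> (snd x)) + (\<phi> (fst y) - \<psi> (snd y))"
        using xy A.functional_add[OF positive_functional_state[OF st(1)], of "fst x" "fst y"]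
          B.functional_add[OF positive_functional_state[OF st(2)], of "snd x" "snd y"]
        by (auto simp: lip_dom_def)
      then have "\<bar>\<phi> (fst (x + y)) - \<psi> (snd (x + y))\<bar> / k \<phi> \<psi> \<le>
          \<bar>\<phi> (fst x) - \<psi> (snd x)\<bar> / k \<phi> \<psi> + \<bar>\<phi> (fst y) - \<psi> (snd y)\<bar> / k \<phi> \<psi>"
        using kpos[OF st] by (simp flip: add_divide_distrib add: divide_right_mono)
      then have "ennreal (\<bar>\<phi> (fst (x + y)) - \<psi> (snd (x + y))\<bar> / k \<phi> \<psi>) \<le>
          ennreal (\<bar>\<phi> (fst x) - \<psi> (snd x)\<bar> / k \<phi> \<psi>) + ennreal (\<bar>\<phi> (fst y) - \<psi> (snd y)\<bar> / k \<phi> \<psi>)"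
        using kpos[OF st] by (subst ennreal_plus[symmetric]) (auto intro!: ennreal_leI simp del: ennreal_plus)
      also have "\<dots> \<le> ?L x + ?L y" by (intro add_mono bridge_lip_ge(3) st)
      finally show "ennreal (\<bar>\<phi> (fst (x + y)) - \<psi> (snd (x + y))\<bar> / k \<phi> \<psi>) \<le> ?L x + ?L y" .
    qed
  next
    fix t x assume x: "x \<in> lip_dom E ?L"
    show "?L (t *\<^sub>R x) \<le> ennreal \<bar>t\<bar> * ?L x"
      unfolding bridge_lip_le_iff
    proof (intro conjI ballI)
      have "LA (fst (t *\<^sub>R x)) = ennreal \<bar>t\<bar> * LA (fst x)" "LB (snd (t *\<^sub>R x)) = ennreal \<bar>t\<bar> * LB (snd x)"
        using A(3) B(3) x unfolding dom seminorm_on_def by (auto simp: mem_Times_iff)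
      then show "LA (fst (t *\<^sub>R x)) \<le> ennreal \<bar>t\<bar> * ?L x" "LB (snd (t *\<^sub>R x)) \<le> ennreal \<bar>t\<bar> * ?L x"
        by (auto intro!: mult_left_mono bridge_lip_ge)
      fix \<phi> \<psi> assume st: "\<phi> \<in> states A" "\<psi> \<in> states B"
      have "\<phi> (fst (t *\<^sub>R x)) - \<psi> (snd (t *\<^sub>R x)) = t * (\<phi> (fst x) - \<psi> (snd x))"
        using x A.functional_scale[OF positive_functional_state[OF st(1)], of "fst x" t]
          B.functional_scale[OF positive_functional_state[OF st(2)], of "snd x" t]
        by (auto simp: lip_dom_def right_diff_distrib)
      then have "ennreal (\<bar>\<phi> (fst (t *\<^sub>R x)) - \<psi> (snd (t *\<^sub>R x))\<bar> / k \<phi> \<psi>) =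
          ennreal \<bar>t\<bar> * ennreal (\<bar>\<phi> (fst x) - \<psi> (snd x)\<bar> / k \<phi> \<psi>)"
        using kpos[OF st] by (simp add: abs_mult flip: ennreal_mult)
      also have "\<dots> \<le> ennreal \<bar>t\<bar> * ?L x" by (intro mult_left_mono bridge_lip_ge(3) st) auto
      finally show "ennreal (\<bar>\<phi> (fst (t *\<^sub>R x)) - \<psi> (snd (t *\<^sub>R x))\<bar> / k \<phi> \<psi>) \<le> ennreal \<bar>t\<bar> * ?L x" .
    qed
  qed
  have ker: "{x \<in> carr E. ?L x = 0} = range (\<lambda>t. t *\<^sub>R ounit E)"
  proof (intro equalityI subsetI)
    fix x assume "x \<in> {x \<in> carr E. ?L x = 0}"
    then have x: "x \<in> carr E" "?L x \<le> 0" by simp_all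
    then have "LA (fst x) \<le> 0" "LB (snd x) \<le> 0" unfolding bridge_lip_le_iff by blast+
    then have "fst x \<in> {a \<in> carr A. LA a = 0}" "snd x \<in> {b \<in> carr B. LB b = 0}"
      using x(1) by (simp_all add: mem_Times_iff)
    then obtain s t where st: "fst x = s *\<^sub>R ounit A" "snd x = t *\<^sub>R ounit B"
      unfolding A(4) B(4) by blast
    (* A summand with zero unit is trivial, and then the scalar of the other summand serves. *)
    consider "ounit A = 0" | "ounit B = 0" | "ounit A \<noteq> 0" "ounit B \<noteq> 0" by blast
    then show "x \<in> range (\<lambda>t. t *\<^sub>R ounit E)"
    proof cases
      case 1
      then have "x = t *\<^sub>R ounit E" using st by (simp add: prod_eq_iff)
      then show ?thesis by blast
    next
      case 2
      then have "x = s *\<^sub>R ounit E" using st by (simp add: prod_eq_iff)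
      then show ?thesis by blast
    next
      case 3
      then obtain \<phi> \<psi> where \<phi>\<psi>: "\<phi> \<in> states A" "\<psi> \<in> states B"
        using A.state_exists B.state_exists by blast
      then have "ennreal (\<bar>\<phi> (fst x) - \<psi> (snd x)\<bar> / k \<phi> \<psi>) \<le> 0"
        using x(2) unfolding bridge_lip_le_iff by blast
      then have "\<bar>\<phi> (fst x) - \<psi> (snd x)\<bar> / k \<phi> \<psi> \<le> 0"
        by (simp add: ennreal_eq_0_iff)
      then have "\<phi> (fst x) = \<psi> (snd x)" using kpos[OF \<phi>\<psi>] by (simp add: divide_le_0_iff)
      moreover have "\<phi> (fst x) = s" "\<psi> (snd x) = t"
        using \<phi>\<psi> A.functional_scale[OF positive_functional_state[OF \<phi>\<psi>(1)], of "ounit A" s]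
          B.functional_scale[OF positive_functional_state[OF \<phi>\<psi>(2)], of "ounit B" t]
        by (auto simp: st states_iff)
      ultimately have "x = s *\<^sub>R ounit E" using st by (simp add: prod_eq_iff)
      then show ?thesis by blast
    qed
  next
    fix x assume "x \<in> range (\<lambda>t. t *\<^sub>R ounit E)"
    then obtain t where x: "x = (t *\<^sub>R ounit A, t *\<^sub>R ounit B)" by auto
    have "LA (t *\<^sub>R ounit A) = 0" "LB (t *\<^sub>R ounit B) = 0" using A(4) B(4) by blast+
    moreover have "ennreal (\<bar>\<phi> (t *\<^sub>R ounit A) - \<psi> (t *\<^sub>R ounit B)\<bar> / k \<phi> \<psi>) \<le> 0"
      if "\<phi> \<in> states A" "\<psi> \<in> states B" for \<phi> \<psi>
      using that A.functional_scale[OF positive_functional_state[OF that(1)], of "ounit A" t]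
          B.functional_scale[OF positive_functional_state[OF that(2)], of "ounit B" t]
      by (auto simp: states_iff)
    ultimately have "LA (t *\<^sub>R ounit A) \<le> 0 \<and> LB (t *\<^sub>R ounit B) \<le> 0 \<and> (\<forall>\<phi>\<in>states A. \<forall>\<psi>\<in>states B.
        ennreal (\<bar>\<phi> (t *\<^sub>R ounit A) - \<psi> (t *\<^sub>R ounit B)\<bar> / k \<phi> \<psi>) \<le> 0)"
      by simp
    then have "?L x \<le> 0" unfolding bridge_lip_le_iff x fst_conv snd_conv by blast
    then show "x \<in> {x \<in> carr E. ?L x = 0}" using x by simp
  qed
  (* Subtract the value at one fixed state. Two states of the same summand are compared by the
     diameter of that summand, two states of different summands by k. *)
  have "\<exists>C\<ge>0. \<forall>a\<in>carr A. \<forall>b\<in>carr B. ?L (a, b) \<le> 1 \<longrightarrow>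
    (\<exists>c. (\<forall>\<phi>\<in>states A. \<bar>\<phi> (a - c *\<^sub>R ounit A)\<bar> \<le> C) \<and> (\<forall>\<psi>\<in>states B. \<bar>\<psi> (b - c *\<^sub>R ounit B)\<bar> \<le> C))"
  proof -
    obtain CA where CA: "CA \<ge> 0"
      "\<forall>\<phi>\<in>states A. \<forall>\<phi>'\<in>states A. \<forall>a\<in>carr A. LA a \<le> 1 \<longrightarrow> \<bar>\<phi> a - \<phi>' a\<bar> \<le> CA"
      using A.lip_norm_bounded_diameter[OF LA] by blast
    obtain CB where CB: "CB \<ge> 0"
      "\<forall>\<phi>\<in>states B. \<forall>\<phi>'\<in>states B. \<forall>a\<in>carr B. LB a \<le> 1 \<longrightarrow> \<bar>\<phi> a - \<phi>' a\<bar> \<le> CB"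
      using B.lip_norm_bounded_diameter[OF LB] by blast
    have "\<exists>c. (\<forall>\<phi>\<in>states A. \<bar>\<phi> (a - c *\<^sub>R ounit A)\<bar> \<le> CA + CB + \<bar>K\<bar>) \<and>
        (\<forall>\<psi>\<in>states B. \<bar>\<psi> (b - c *\<^sub>R ounit B)\<bar> \<le> CA + CB + \<bar>K\<bar>)"
      if ab: "a \<in> carr A" "b \<in> carr B" "?L (a, b) \<le> 1" for a b
    proof -
      have shiftA: "\<phi> (a - c *\<^sub>R ounit A) = \<phi> a - c" if "\<phi> \<in> states A" for \<phi> c
        using that ab A.functional_diff[OF positive_functional_state[OF that], of a "c *\<^sub>R ounit A"]
          A.functional_scale[OF positive_functional_state[OF that], of "ounit A" c]
        by (auto simp: states_iff)
      have shiftB: "\<psi> (b - c *\<^sub>R ounit B) = \<psi> b - c" if "\<psi> \<in> states B" for \<psi> c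
        using that ab B.functional_diff[OF positive_functional_state[OF that], of b "c *\<^sub>R ounit B"]
          B.functional_scale[OF positive_functional_state[OF that], of "ounit B" c]
        by (auto simp: states_iff)
      show ?thesis
      proof (cases "states A = {}")
        case False
        then obtain \<omega> where \<omega>: "\<omega> \<in> states A" by blast
        have "\<bar>\<phi> a - \<omega> a\<bar> \<le> CA + CB + \<bar>K\<bar>" if "\<phi> \<in> states A" for \<phi>
        proof -
          have "LA a \<le> 1" using ab le1 by blast
          then have "\<bar>\<phi> a - \<omega> a\<bar> \<le> CA" using CA(2) that \<omega> ab(1) by blast
          then show ?thesis using CB(1) by linarith
        qed
        moreover have "\<bar>\<psi> b - \<omega> a\<bar> \<le> CA + CB + \<bar>K\<bar>" if "\<psi> \<in> states B" for \<psi>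
        proof -
          have "\<bar>\<omega> a - \<psi> b\<bar> \<le> k \<omega> \<psi>" using \<omega> that ab le1 by blast
          then show ?thesis using k[OF \<omega> that] CA(1) CB(1) by linarith
        qed
        ultimately show ?thesis using shiftA shiftB by (intro exI[of _ "\<omega> a"]) simp
      next
        case True
        show ?thesis
        proof (cases "states B = {}")
          case False
          then obtain \<omega> where \<omega>: "\<omega> \<in> states B" by blast
          have "\<bar>\<psi> b - \<omega> b\<bar> \<le> CA + CB + \<bar>K\<bar>" if "\<psi> \<in> states B" for \<psi>
          proof -
            have "LB b \<le> 1" using ab le1 by blast
            then have "\<bar>\<psi> b - \<omega> b\<bar> \<le> CB" using CB(2) that \<omega> ab(2) by blast
            then show ?thesis using CA(1) by linarith
          qed
          then show ?thesis using True shiftB by (intro exI[of _ "\<omega> b"]) simp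
        qed (use True in auto)
      qed
    qed
    then show ?thesis using CA(1) CB(1) by (intro exI[of _ "CA + CB + \<bar>K\<bar>"]) auto
  qed
  then obtain C where C: "C \<ge> 0" "\<And>a b. a \<in> carr A \<Longrightarrow> b \<in> carr B \<Longrightarrow> ?L (a, b) \<le> 1 \<Longrightarrow>
    \<exists>c. (\<forall>\<phi>\<in>states A. \<bar>\<phi> (a - c *\<^sub>R ounit A)\<bar> \<le> C) \<and> (\<forall>\<psi>\<in>states B. \<bar>\<psi> (b - c *\<^sub>R ounit B)\<bar> \<le> C)"
    by blast
  (* Two states agree on multiples of the unit, so their difference can be computed on the
     shifted element, where the components are bounded. *)
  have shift: "\<mu> (a, b) - \<nu> (a, b) =
      (\<mu> (a - c *\<^sub>R ounit A, 0) - \<nu> (a - c *\<^sub>R ounit A, 0)) + (\<mu> (0, b - c *\<^sub>R ounit B) - \<nu> (0, b - c *\<^sub>R ounit B))"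
    if "\<mu> \<in> states E" "\<nu> \<in> states E" "a \<in> carr A" "b \<in> carr B" for \<mu> \<nu> a b c
  proof -
    have "\<xi> (a, b) = \<xi> (a - c *\<^sub>R ounit A, 0) + \<xi> (0, b - c *\<^sub>R ounit B) + c" if \<xi>: "\<xi> \<in> states E" for \<xi>
    proof -
      note pf = positive_functional_state[OF \<xi>]
      have "(a, b) = (a - c *\<^sub>R ounit A, b - c *\<^sub>R ounit B) + c *\<^sub>R ounit E" by simp
      then have "\<xi> (a, b) = \<xi> ((a - c *\<^sub>R ounit A, b - c *\<^sub>R ounit B) + c *\<^sub>R ounit E)" by (rule arg_cong)
      also have "\<dots> = \<xi> (a - c *\<^sub>R ounit A, b - c *\<^sub>R ounit B) + c * \<xi> (ounit E)"
        using \<open>a \<in> carr A\<close> \<open>b \<in> carr B\<close>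
          E.functional_add[OF pf, of "(a - c *\<^sub>R ounit A, b - c *\<^sub>R ounit B)" "c *\<^sub>R ounit E"]
          E.functional_scale[OF pf, of "ounit E" c] by simp
      also have "\<xi> (ounit E) = 1" using \<xi> by (simp add: states_iff)
      also have "\<xi> (a - c *\<^sub>R ounit A, b - c *\<^sub>R ounit B) = \<xi> (a - c *\<^sub>R ounit A, 0) + \<xi> (0, b - c *\<^sub>R ounit B)"
        using \<open>a \<in> carr A\<close> \<open>b \<in> carr B\<close> by (intro functional_split[OF pf]) auto
      finally show ?thesis by simp
    qed
    from this[OF that(1)] this[OF that(2)] show ?thesis by simp
  qed
  have fin: "\<forall>\<mu>\<in>states E. \<forall>\<nu>\<in>states E. mk E ?L \<mu> \<nu> < \<infinity>"
  proof (intro ballI)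
    fix \<mu> \<nu> assume \<mu>\<nu>: "\<mu> \<in> states E" "\<nu> \<in> states E"
    have "mk E ?L \<mu> \<nu> \<le> ennreal (2 * C)"
      unfolding mk_le_iff
    proof (intro ballI impI ennreal_leI)
      fix x assume x: "x \<in> carr E" "?L x \<le> 1"
      obtain a b where ab: "x = (a, b)" "a \<in> carr A" "b \<in> carr B" using x by auto
      obtain c where c: "\<forall>\<phi>\<in>states A. \<bar>\<phi> (a - c *\<^sub>R ounit A)\<bar> \<le> C" "\<forall>\<psi>\<in>states B. \<bar>\<psi> (b - c *\<^sub>R ounit B)\<bar> \<le> C"
        using C(2)[of a b] x ab by blast
      have "\<bar>\<xi> (a - c *\<^sub>R ounit A, 0)\<bar> + \<bar>\<xi> (0, b - c *\<^sub>R ounit B)\<bar> \<le> C" if \<xi>: "\<xi> \<in> states E" for \<xi>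
      proof -
        note pf = positive_functional_state[OF \<xi>]
        have "\<bar>\<xi> (a - c *\<^sub>R ounit A, 0)\<bar> \<le> \<xi> (ounit A, 0) * C"
          using A.functional_bound_by_states[OF functional_left[OF pf], of "a - c *\<^sub>R ounit A" C] c ab by simp
        moreover have "\<bar>\<xi> (0, b - c *\<^sub>R ounit B)\<bar> \<le> \<xi> (0, ounit B) * C"
          using B.functional_bound_by_states[OF functional_right[OF pf], of "b - c *\<^sub>R ounit B" C] c ab by simp
        moreover have "\<xi> (ounit A, 0) * C + \<xi> (0, ounit B) * C = C"
          using state_units[OF \<xi>] by (simp flip: distrib_right)
        ultimately show ?thesis by linarith
      qed
      from this[OF \<mu>\<nu>(1)] this[OF \<mu>\<nu>(2)] show "\<bar>\<mu> x - \<nu> x\<bar> \<le> 2 * C"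
        using shift[OF \<mu>\<nu> ab(2,3), of c] unfolding ab(1) by linarith
    qed
    then show "mk E ?L \<mu> \<nu> < \<infinity>" by (rule le_less_trans) simp
  qed
  have fine: "\<exists>F \<delta>. finite F \<and> F \<subseteq> carr E \<and> 0 < \<delta> \<and>
        (\<forall>\<nu>\<in>states E. (\<forall>x\<in>F. \<bar>\<nu> x - \<mu> x\<bar> < \<delta>) \<longrightarrow> mk E ?L \<mu> \<nu> \<le> ennreal r)"
    if \<mu>: "\<mu> \<in> states E" and r: "r > 0" for \<mu> r
  proof -
    note pf = positive_functional_state[OF \<mu>]
    obtain F \<delta> where F: "finite F" "F \<subseteq> carr A" "0 < \<delta>"
      "\<forall>\<alpha>. positive_functional A \<alpha> \<longrightarrow> (\<forall>a\<in>F. \<bar>\<alpha> a - \<mu> (a, 0)\<bar> < \<delta>) \<longrightarrow>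
        (\<forall>a\<in>carr A. LA a \<le> 1 \<longrightarrow> (\<forall>\<phi>\<in>states A. \<bar>\<phi> a\<bar> \<le> C) \<longrightarrow> \<bar>\<alpha> a - \<mu> (a, 0)\<bar> \<le> r / 2)"
      using A.lip_norm_uniform_on_functionals[OF LA functional_left[OF pf] half_gt_zero[OF r] C(1)] by blast
    obtain G \<eta> where G: "finite G" "G \<subseteq> carr B" "0 < \<eta>"
      "\<forall>\<beta>. positive_functional B \<beta> \<longrightarrow> (\<forall>b\<in>G. \<bar>\<beta> b - \<mu> (0, b)\<bar> < \<eta>) \<longrightarrow>
        (\<forall>b\<in>carr B. LB b \<le> 1 \<longrightarrow> (\<forall>\<psi>\<in>states B. \<bar>\<psi> b\<bar> \<le> C) \<longrightarrow> \<bar>\<beta> b - \<mu> (0, b)\<bar> \<le> r / 2)"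
      using B.lip_norm_uniform_on_functionals[OF LB functional_right[OF pf] half_gt_zero[OF r] C(1)] by blast
    define H where "H = (\<lambda>a. (a, 0)) ` F \<union> (\<lambda>b. (0, b)) ` G"
    have "mk E ?L \<mu> \<nu> \<le> ennreal r"
      if \<nu>: "\<nu> \<in> states E" "\<forall>x\<in>H. \<bar>\<nu> x - \<mu> x\<bar> < min \<delta> \<eta>" for \<nu>
      unfolding mk_le_iff
    proof (intro ballI impI ennreal_leI)
      note pf\<nu> = positive_functional_state[OF \<nu>(1)]
      fix x assume x: "x \<in> carr E" "?L x \<le> 1"
      obtain a b where ab: "x = (a, b)" "a \<in> carr A" "b \<in> carr B" using x by auto
      obtain c where c: "\<forall>\<phi>\<in>states A. \<bar>\<phi> (a - c *\<^sub>R ounit A)\<bar> \<le> C" "\<forall>\<psi>\<in>states B. \<bar>\<psi> (b - c *\<^sub>R ounit B)\<bar> \<le> C"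
        using C(2)[of a b] x ab by blast
      have "LA a \<le> 1" "LB b \<le> 1" using x ab le1 by auto
      then have "LA (a - c *\<^sub>R ounit A) \<le> 1" "LB (b - c *\<^sub>R ounit B) \<le> 1"
        using A.seminorm_unit_shift[OF LA] B.seminorm_unit_shift[OF LB] ab by auto
      moreover have "\<forall>a\<in>F. \<bar>\<nu> (a, 0) - \<mu> (a, 0)\<bar> < \<delta>" "\<forall>b\<in>G. \<bar>\<nu> (0, b) - \<mu> (0, b)\<bar> < \<eta>"
        using \<nu>(2) by (auto simp: H_def)
      ultimately have "\<bar>\<nu> (a - c *\<^sub>R ounit A, 0) - \<mu> (a - c *\<^sub>R ounit A, 0)\<bar> \<le> r / 2"
          "\<bar>\<nu> (0, b - c *\<^sub>R ounit B) - \<mu> (0, b - c *\<^sub>R ounit B)\<bar> \<le> r / 2"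
        using F(4)[THEN spec, THEN mp, OF functional_left[OF pf\<nu>]] G(4)[THEN spec, THEN mp, OF functional_right[OF pf\<nu>]]
          c ab by auto
      then show "\<bar>\<mu> x - \<nu> x\<bar> \<le> r"
        using shift[OF \<nu>(1) \<mu> ab(2,3), of c] unfolding ab(1) by linarith
    qed
    moreover have "finite H" "H \<subseteq> carr E" using F G by (auto simp: H_def)
    ultimately show ?thesis using F(3) G(3) by (intro exI[of _ H] exI[of _ "min \<delta> \<eta>"]) auto
  qed
  have closed: "?L x \<le> 1"
    if x: "x \<in> carr E" "\<forall>e>0. \<exists>y\<in>carr E. ?L y \<le> 1 \<and> order_bounded E e (x - y)" for x
  proof -
    obtain a b where ab: "x = (a, b)" "a \<in> carr A" "b \<in> carr B" using x by auto
    have near: "\<exists>y\<in>carr A. \<exists>z\<in>carr B. ?L (y, z) \<le> 1 \<and> order_bounded A e (a - y) \<and> order_bounded B e (b - z)"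
      if "e > 0" for e
      using x(2) that ab(1) by (auto simp: order_bounded_direct_sum)
    have "LA a \<le> 1" using A(5) near ab(2) le1 by blast
    moreover have "LB b \<le> 1" using B(5) near ab(3) le1 by blast
    moreover have "\<bar>\<phi> a - \<psi> b\<bar> \<le> k \<phi> \<psi>" if st: "\<phi> \<in> states A" "\<psi> \<in> states B" for \<phi> \<psi>
    proof (rule field_le_epsilon)
      fix e :: real assume "e > 0"
      then obtain y z where yz: "y \<in> carr A" "z \<in> carr B" "?L (y, z) \<le> 1"
        "order_bounded A (e / 2) (a - y)" "order_bounded B (e / 2) (b - z)"
        using near[of "e / 2"] by auto
      have "\<bar>\<phi> y - \<psi> z\<bar> \<le> k \<phi> \<psi>" using yz(3) le1 st by blast
      moreover have "\<bar>\<phi> a - \<phi> y\<bar> \<le> e / 2"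
        using A.state_bound[OF st(1) _ yz(4)] A.functional_diff[OF positive_functional_state[OF st(1)] ab(2) yz(1)]
          ab yz by simp
      moreover have "\<bar>\<psi> b - \<psi> z\<bar> \<le> e / 2"
        using B.state_bound[OF st(2) _ yz(5)] B.functional_diff[OF positive_functional_state[OF st(2)] ab(3) yz(2)]
          ab yz by simp
      ultimately show "\<bar>\<phi> a - \<psi> b\<bar> \<le> k \<phi> \<psi> + e" by linarith
    qed
    ultimately show ?thesis using ab(1) le1 by blast
  qed
  have dense: "\<exists>y\<in>lip_dom E ?L. order_bounded E e (x - y)" if x: "x \<in> carr E" "e > 0" for x e
  proof -
    obtain a b where ab: "x = (a, b)" "a \<in> carr A" "b \<in> carr B" using x by auto
    then obtain y z where "y \<in> lip_dom A LA" "order_bounded A e (a - y)"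
        "z \<in> lip_dom B LB" "order_bounded B e (b - z)"
      using A(2) B(2) x(2) by blast
    then show ?thesis unfolding dom ab(1)
      by (intro bexI[of _ "(y, z)"]) (auto simp: order_bounded_direct_sum)
  qed
  show ?thesis
    unfolding E.lip_norm_iff
  proof (intro conjI)
    show "\<forall>x\<in>carr E. \<forall>e>0. \<exists>y\<in>lip_dom E ?L. order_bounded E e (x - y)"
      using dense by blast
    show "\<forall>\<mu>\<in>states E. \<forall>r>0. \<exists>F \<delta>. finite F \<and> F \<subseteq> carr E \<and> 0 < \<delta> \<and>
        (\<forall>\<nu>\<in>states E. (\<forall>x\<in>F. \<bar>\<nu> x - \<mu> x\<bar> < \<delta>) \<longrightarrow> mk E ?L \<mu> \<nu> \<le> ennreal r)"
      by (intro ballI allI impI fine)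
    show "\<forall>x\<in>carr E. (\<forall>e>0. \<exists>y\<in>carr E. ?L y \<le> 1 \<and> order_bounded E e (x - y)) \<longrightarrow> ?L x \<le> 1"
      by (intro ballI impI closed)
  qed (fact sub semi ker fin)+
qed

end

section \<open>From tunnels to bridges and back\<close>

lemma ennreal_le_INF_add:
  fixes x :: ennreal
  assumes "\<And>i. i \<in> I \<Longrightarrow> x \<le> f i + ennreal e"
  shows "x \<le> (INF i\<in>I. f i) + ennreal e"
proof -
  have "x - ennreal e \<le> (INF i\<in>I. f i)"
    using assms by (intro INF_greatest) (simp add: ennreal_minus_le_iff add.commute)
  then show ?thesis by (simp add: ennreal_minus_le_iff add.commute)
qed

text \<open>
  A tunnel compares states of \<open>A\<close> and of \<open>B\<close> by the distance of their pullbacks to \<open>D\<close>. Prescribing this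
  distance, increased by \<open>\<epsilon>\<close>, in a bridge seminorm bounds the distances in the direct sum. The
  bridge seminorm is admissible because the pair of images of an element of \<open>D\<close> has bridge seminorm
  at most the seminorm of that element, and each element of \<open>A\<close> or \<open>B\<close> lifts to \<open>D\<close> with almost the
  same seminorm. Since the pullbacks from \<open>A\<close> are states of \<open>D\<close>, each lies within the extent
  of the pullbacks from \<open>B\<close>, and conversely.
\<close>

lemma dist_q_le_extent:
  assumes A: "quantum_metric_ou_space A LA" and B: "quantum_metric_ou_space B LB"
    and \<tau>: "ou_tunnel A LA B LB \<tau>" and \<epsilon>: "\<epsilon> > 0"
  shows "dist_q A LA B LB \<le> extent A B \<tau> + ennreal \<epsilon>"
proof -
  define D where "D = tspace \<tau>"
  define LD where "LD = tlip \<tau>"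
  define p where "p = tleft \<tau>"
  define q where "q = tright \<tau>"
  have D: "order_unit_space D" "lip_norm D LD"
    and p: "positive_unital D A p" "\<forall>a\<in>carr A. LA a = (INF d\<in>{d \<in> carr D. p d = a}. LD d)"
    and q: "positive_unital D B q" "\<forall>b\<in>carr B. LB b = (INF d\<in>{d \<in> carr D. q d = b}. LD d)"
    using \<tau> by (auto simp: ou_tunnel_def quantum_metric_ou_space_def quantum_ou_isometry_def
        D_def LD_def p_def q_def)
  interpret ou_pair A B
    using A B by unfold_locales (auto simp: quantum_metric_ou_space_def)
  interpret D: ou D by unfold_locales fact
  have LA: "lip_norm A LA" and LB: "lip_norm B LB"
    using A B by (auto simp: quantum_metric_ou_space_def)
  have LD: "seminorm_on (lip_dom D LD) LD" "\<forall>\<phi>\<in>states D. \<forall>\<psi>\<in>states D. mk D LD \<phi> \<psi> < \<infinity>"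
    using D(2) unfolding D.lip_norm_iff by auto
  have pD: "p d \<in> carr A" and qD: "q d \<in> carr B" if "d \<in> carr D" for d
    using p(1) q(1) that by (auto simp: positive_unital_def)
  define P where "P \<phi> = compose (carr D) \<phi> p" for \<phi> :: "'a \<Rightarrow> real"
  define Q where "Q \<psi> = compose (carr D) \<psi> q" for \<psi> :: "'b \<Rightarrow> real"
  have P: "pullback_states D A p = P ` states A" and Q: "pullback_states D B q = Q ` states B"
    by (simp_all add: pullback_states_def P_def Q_def)
  have Pst: "P \<phi> \<in> states D" if "\<phi> \<in> states A" for \<phi>
    using pullback_states_subset[OF D(1) p(1)] that unfolding P by blast
  have Qst: "Q \<psi> \<in> states D" if "\<psi> \<in> states B" for \<psi>
    using pullback_states_subset[OF D(1) q(1)] that unfolding Q by blast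
  define m where "m \<phi> \<psi> = enn2real (mk D LD (P \<phi>) (Q \<psi>))" for \<phi> \<psi>
  have m: "mk D LD (P \<phi>) (Q \<psi>) = ennreal (m \<phi> \<psi>)" "0 \<le> m \<phi> \<psi>"
    if "\<phi> \<in> states A" "\<psi> \<in> states B" for \<phi> \<psi>
    using LD(2) Pst[OF that(1)] Qst[OF that(2)] by (auto simp: m_def)
  obtain C where C: "C \<ge> 0"
    "\<forall>\<phi>\<in>states D. \<forall>\<psi>\<in>states D. \<forall>d\<in>carr D. LD d \<le> 1 \<longrightarrow> \<bar>\<phi> d - \<psi> d\<bar> \<le> C"
    using D.lip_norm_bounded_diameter[OF D(2)] by blast
  have mC: "m \<phi> \<psi> \<le> C" if "\<phi> \<in> states A" "\<psi> \<in> states B" for \<phi> \<psi>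
  proof -
    have "mk D LD (P \<phi>) (Q \<psi>) \<le> ennreal C"
      using C Pst[OF that(1)] Qst[OF that(2)] by (simp add: mk_le_ennreal_iff)
    then show ?thesis using m[OF that] C(1) by simp
  qed
  define k where "k \<phi> \<psi> = m \<phi> \<psi> + \<epsilon>" for \<phi> \<psi>
  define L where "L = bridge_lip A LA B LB k"
  have k: "\<epsilon> \<le> k \<phi> \<psi> \<and> k \<phi> \<psi> \<le> C + \<epsilon>" if "\<phi> \<in> states A" "\<psi> \<in> states B" for \<phi> \<psi>
    using m(2)[OF that] mC[OF that] by (simp add: k_def)
  have "lip_norm E L"
    unfolding L_def using LA LB \<epsilon> k by (rule lip_norm_bridge)
  have L_le: "L (p d, q d) \<le> LD d" if d: "d \<in> carr D" for d
    unfolding L_def bridge_lip_le_iff fst_conv snd_conv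
  proof (intro conjI ballI)
    show "LA (p d) \<le> LD d"
      using p(2) pD[OF d] d by (auto intro: INF_lower)
    show "LB (q d) \<le> LD d"
      using q(2) qD[OF d] d by (auto intro: INF_lower)
    fix \<phi> \<psi> assume st: "\<phi> \<in> states A" "\<psi> \<in> states B"
    show "ennreal (\<bar>\<phi> (p d) - \<psi> (q d)\<bar> / k \<phi> \<psi>) \<le> LD d"
    proof (cases "LD d")
      case (real r)
      have "\<bar>\<phi> (p d) - \<psi> (q d)\<bar> / k \<phi> \<psi> \<le> r"
      proof (rule field_le_epsilon)
        (* Elements of seminorm 0 cannot be scaled to seminorm 1, hence the margin s. *)
        fix s :: real assume "s > 0"
        then have "\<bar>P \<phi> d - Q \<psi> d\<bar> \<le> (r + s) * m \<phi> \<psi>"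
          using real m[OF st]
          by (intro D.mk_lipschitz[OF LD(1) Pst[OF st(1)] Qst[OF st(2)] d]) (auto intro: ennreal_leI simp del: ennreal_plus)
        also have "\<dots> \<le> (r + s) * k \<phi> \<psi>"
          using real \<open>s > 0\<close> \<epsilon> by (intro mult_left_mono) (auto simp: k_def)
        finally have "\<bar>\<phi> (p d) - \<psi> (q d)\<bar> \<le> (r + s) * k \<phi> \<psi>"
          using d by (simp add: P_def Q_def compose_def)
        then show "\<bar>\<phi> (p d) - \<psi> (q d)\<bar> / k \<phi> \<psi> \<le> r + s"
          using k[OF st] \<epsilon> by (simp add: divide_le_eq)
      qed
      then show ?thesis using real by (simp add: ennreal_leI)
    qed simp
  qed
  have "admissible A LA B LB L"
    unfolding admissible_def
  proof (intro conjI ballI)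
    show "lip_norm E L" by fact
    fix a assume a: "a \<in> carr A"
    show "LA a = (INF b\<in>carr B. L (a, b))"
    proof (rule antisym)
      show "LA a \<le> (INF b\<in>carr B. L (a, b))"
        unfolding L_def using bridge_lip_ge(1)[of LA "(a, _)"] by (intro INF_greatest) simp
      have "(INF b\<in>carr B. L (a, b)) \<le> LD d" if "d \<in> carr D" "p d = a" for d
        using L_le[OF that(1)] qD[OF that(1)] that(2) by (intro INF_lower2[of "q d"]) auto
      then show "(INF b\<in>carr B. L (a, b)) \<le> LA a"
        using p(2) a by (auto intro: INF_greatest)
    qed
  next
    fix b assume b: "b \<in> carr B"
    show "LB b = (INF a\<in>carr A. L (a, b))"
    proof (rule antisym)
      show "LB b \<le> (INF a\<in>carr A. L (a, b))"
        unfolding L_def using bridge_lip_ge(2)[of LB "(_, b)"] by (intro INF_greatest) simp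
      have "(INF a\<in>carr A. L (a, b)) \<le> LD d" if "d \<in> carr D" "q d = b" for d
        using L_le[OF that(1)] pD[OF that(1)] that(2) by (intro INF_lower2[of "p d"]) auto
      then show "(INF a\<in>carr A. L (a, b)) \<le> LB b"
        using q(2) b by (auto intro: INF_greatest)
    qed
  qed
  then have "dist_q A LA B LB \<le>
      hausdorff_distance (mk E L) (pullback_states E A fst) (pullback_states E B snd)"
    unfolding dist_q_def by (intro INF_lower) simp
  also have "\<dots> \<le> extent A B \<tau> + ennreal \<epsilon>"
  proof -
    define i1 where "i1 \<phi> = compose (carr E) \<phi> fst" for \<phi> :: "'a \<Rightarrow> real"
    define i2 where "i2 \<psi> = compose (carr E) \<psi> snd" for \<psi> :: "'b \<Rightarrow> real"
    have cross: "mk E L (i1 \<phi>) (i2 \<psi>) \<le> mk D LD (P \<phi>) (Q \<psi>) + ennreal \<epsilon>"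
      if st: "\<phi> \<in> states A" "\<psi> \<in> states B" for \<phi> \<psi>
    proof -
      have "mk E L (i1 \<phi>) (i2 \<psi>) \<le> ennreal (k \<phi> \<psi>)"
        unfolding mk_le_iff
      proof (intro ballI impI ennreal_leI)
        fix x assume x: "x \<in> carr E" "L x \<le> 1"
        have "ennreal (\<bar>\<phi> (fst x) - \<psi> (snd x)\<bar> / k \<phi> \<psi>) \<le> ennreal 1"
          using x(2) st unfolding L_def bridge_lip_le_iff by simp
        then have "\<bar>\<phi> (fst x) - \<psi> (snd x)\<bar> / k \<phi> \<psi> \<le> 1" by (simp del: ennreal_1)
        then show "\<bar>i1 \<phi> x - i2 \<psi> x\<bar> \<le> k \<phi> \<psi>"
          using k[OF st] \<epsilon> x(1) by (simp add: i1_def i2_def compose_def divide_le_eq)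
      qed
      also have "\<dots> = mk D LD (P \<phi>) (Q \<psi>) + ennreal \<epsilon>" using m[OF st] \<epsilon> by (simp add: k_def)
      finally show ?thesis .
    qed
    have far: "(INF y\<in>Y. mk D LD x y) \<le> hausdorff_distance (mk D LD) (states D) Y"
      if "x \<in> states D" for x Y
      unfolding hausdorff_distance_def using that by (intro max.coboundedI1 SUP_upper)
    have ext: "extent A B \<tau> = max (hausdorff_distance (mk D LD) (states D) (P ` states A))
        (hausdorff_distance (mk D LD) (states D) (Q ` states B))"
      unfolding extent_def Let_def by (simp add: P Q flip: D_def LD_def p_def q_def)
    have "(INF \<psi>\<in>states B. mk E L (i1 \<phi>) (i2 \<psi>)) \<le> extent A B \<tau> + ennreal \<epsilon>" if "\<phi> \<in> states A" for \<phi>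
    proof -
      have "(INF \<psi>\<in>states B. mk E L (i1 \<phi>) (i2 \<psi>)) \<le> (INF \<psi>\<in>states B. mk D LD (P \<phi>) (Q \<psi>)) + ennreal \<epsilon>"
        using cross[OF that] by (intro ennreal_le_INF_add) (rule INF_lower2)
      also have "\<dots> \<le> extent A B \<tau> + ennreal \<epsilon>"
        using far[OF Pst[OF that], of "Q ` states B"] unfolding ext
        by (intro add_right_mono max.coboundedI2) (simp add: image_image)
      finally show ?thesis .
    qed
    moreover have "(INF \<phi>\<in>states A. mk E L (i1 \<phi>) (i2 \<psi>)) \<le> extent A B \<tau> + ennreal \<epsilon>" if "\<psi> \<in> states B" for \<psi>
    proof -
      have "(INF \<phi>\<in>states A. mk E L (i1 \<phi>) (i2 \<psi>)) \<le> (INF \<phi>\<in>states A. mk D LD (P \<phi>) (Q \<psi>)) + ennreal \<epsilon>"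
        using cross[OF _ that] by (intro ennreal_le_INF_add) (rule INF_lower2)
      also have "\<dots> = (INF \<phi>\<in>states A. mk D LD (Q \<psi>) (P \<phi>)) + ennreal \<epsilon>" by (simp add: mk_commute)
      also have "\<dots> \<le> extent A B \<tau> + ennreal \<epsilon>"
        using far[OF Qst[OF that], of "P ` states A"] unfolding ext
        by (intro add_right_mono max.coboundedI1) (simp add: image_image)
      finally show ?thesis .
    qed
    ultimately show ?thesis
      unfolding hausdorff_distance_def pullback_states_def i1_def[symmetric] i2_def[symmetric]
      by (auto simp: image_image intro!: SUP_least)
  qed
  finally show ?thesis .
qed

text \<open>
  The direct sum with its coordinate projections is a tunnel, placed into the ambient type as
  \<open>A \<times> B \<times> {0}\<close>. Its state space is the join of the two embedded state spaces, so it is no farther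
  from either of them than they are from each other.
\<close>

lemma extent_le_admissible:
  fixes A :: "'a::real_vector ou_space" and B :: "'b::real_vector ou_space"
  assumes A: "quantum_metric_ou_space A LA" and B: "quantum_metric_ou_space B LB"
    and L: "admissible A LA B LB L"
  shows "\<exists>\<tau> :: ('a \<times> 'b \<times> 'd::real_vector, 'a, 'b) tunnel. ou_tunnel A LA B LB \<tau> \<and>
    extent A B \<tau> \<le> hausdorff_distance (mk (direct_sum A B) L)
      (pullback_states (direct_sum A B) A fst) (pullback_states (direct_sum A B) B snd)"
proof -
  interpret ou_pair A B
    using A B by unfold_locales (auto simp: quantum_metric_ou_space_def)
  define j :: "'a \<times> 'b \<Rightarrow> 'a \<times> 'b \<times> 'd" where "j x = (fst x, snd x, 0)" for x
  define g :: "'a \<times> 'b \<times> 'd \<Rightarrow> 'a \<times> 'b" where "g x = (fst x, fst (snd x))" for x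
  interpret copy: ou_copy E j g
    by unfold_locales (auto simp: j_def g_def linear_iff)
  let ?M = "space_copy j g E"
  define \<tau> where "\<tau> = \<lparr>tspace = ?M, tlip = L \<circ> g, tleft = fst \<circ> g, tright = snd \<circ> g\<rparr>"
  have "lip_norm ?M (L \<circ> g)" using L by (intro copy.lip_norm_copy) (simp add: admissible_def)
  moreover have "norm_complete ?M"
    using A B by (intro copy.norm_complete_copy norm_complete_direct_sum) (auto simp: quantum_metric_ou_space_def)
  ultimately have "quantum_metric_ou_space ?M (L \<circ> g)"
    using copy.order_unit_space_copy by (simp add: quantum_metric_ou_space_def)
  moreover have "quantum_ou_isometry ?M (L \<circ> g) A LA (fst \<circ> g)"
    unfolding quantum_ou_isometry_def
  proof (intro conjI ballI)
    show "positive_unital ?M A (fst \<circ> g)"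
      by (auto simp: positive_unital_def lin_on_def copy.g_simps)
    fix a assume a: "a \<in> carr A"
    have "{x \<in> carr ?M. (fst \<circ> g) x = a} = (\<lambda>b. j (a, b)) ` carr B"
      using a by (auto simp: j_def g_def image_iff)
    then show "LA a = (INF x\<in>{x \<in> carr ?M. (fst \<circ> g) x = a}. (L \<circ> g) x)"
      using L a by (simp add: admissible_def image_image)
  qed
  moreover have "quantum_ou_isometry ?M (L \<circ> g) B LB (snd \<circ> g)"
    unfolding quantum_ou_isometry_def
  proof (intro conjI ballI)
    show "positive_unital ?M B (snd \<circ> g)"
      by (auto simp: positive_unital_def lin_on_def copy.g_simps)
    fix b assume b: "b \<in> carr B"
    have "{x \<in> carr ?M. (snd \<circ> g) x = b} = (\<lambda>a. j (a, b)) ` carr A"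
      using b by (auto simp: j_def g_def image_iff)
    then show "LB b = (INF x\<in>{x \<in> carr ?M. (snd \<circ> g) x = b}. (L \<circ> g) x)"
      using L b by (simp add: admissible_def image_image)
  qed
  moreover have "(fst \<circ> g) ` carr ?M = carr A" "(snd \<circ> g) ` carr ?M = carr B"
  proof -
    have "g ` carr ?M = carr A \<times> carr B" by (simp add: image_image)
    moreover have "carr A \<noteq> {}" "carr B \<noteq> {}" using A.zero_mem B.zero_mem by blast+
    ultimately show "(fst \<circ> g) ` carr ?M = carr A" "(snd \<circ> g) ` carr ?M = carr B"
      by (simp_all only: image_comp[symmetric] fst_image_times snd_image_times if_False)
  qed
  ultimately have "ou_tunnel A LA B LB \<tau>" by (simp add: ou_tunnel_def \<tau>_def)
  moreover have "extent A B \<tau> \<le> hausdorff_distance (mk E L) (pullback_states E A fst) (pullback_states E B snd)"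
    unfolding extent_def Let_def
    by (simp add: \<tau>_def copy.pullback_states_copy copy.push_states copy.hausdorff_distance_push
        extent_direct_sum_le del: space_copy_simps)
  ultimately show ?thesis by blast
qed

theorem theorem5p5:
  fixes A :: "'a::real_vector ou_space" and LA :: "'a \<Rightarrow> ennreal"
    and B :: "'b::real_vector ou_space" and LB :: "'b \<Rightarrow> ennreal"
  assumes "quantum_metric_ou_space A LA"
    and "quantum_metric_ou_space B LB"
  shows "dist_q A LA B LB = Inf (tunnel_extents TYPE('d::real_vector) A LA B LB)"
proof (rule antisym)
  show "dist_q A LA B LB \<le> Inf (tunnel_extents TYPE('d) A LA B LB)"
  proof (rule Inf_greatest)
    fix x assume "x \<in> tunnel_extents TYPE('d) A LA B LB"
    then obtain \<tau> :: "('a \<times> 'b \<times> 'd, 'a, 'b) tunnel" where "ou_tunnel A LA B LB \<tau>" "x = extent A B \<tau>"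
      by (auto simp: tunnel_extents_def)
    then show "dist_q A LA B LB \<le> x"
      by (simp add: ennreal_le_epsilon dist_q_le_extent[OF assms])
  qed
  show "Inf (tunnel_extents TYPE('d) A LA B LB) \<le> dist_q A LA B LB"
    unfolding dist_q_def
  proof (rule INF_greatest)
    fix L assume "L \<in> {L. admissible A LA B LB L}"
    then obtain \<tau> :: "('a \<times> 'b \<times> 'd, 'a, 'b) tunnel" where "ou_tunnel A LA B LB \<tau>"
      "extent A B \<tau> \<le> hausdorff_distance (mk (direct_sum A B) L)
        (pullback_states (direct_sum A B) A fst) (pullback_states (direct_sum A B) B snd)"
      using extent_le_admissible[OF assms] by blast
    then show "Inf (tunnel_extents TYPE('d) A LA B LB) \<le> hausdorff_distance (mk (direct_sum A B) L)
        (pullback_states (direct_sum A B) A fst) (pullback_states (direct_sum A B) B snd)"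
      by (intro Inf_lower2) (auto simp: tunnel_extents_def)
  qed
qed

end
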